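(* Let $\Omega\subset\mathbb{R}^d$ be a bounded domain. Suppose that the activation function $\sigma\in BV(\mathbb{R})$ is non-constant. Then there is a constant $C(\mathrm{diam}(\Omega),\sigma)$, depending only on $\mathrm{diam}(\Omega)$ and $\sigma$, such that for every $f\in\mathcal{B}^1$ and every integer $n\ge1$, $$\inf_{f_n\in\Sigma_d^n(\sigma)}\|f-f_n\|_{L^2(\Omega)}\le|\Omega|^{1/2}\,C(\mathrm{diam}(\Omega),\sigma)\,n^{-1/4}\,\|f\|_{\mathcal{B}^1}.$$
   Context: $BV(\mathbb{R})$ denotes the functions $\sigma:\mathbb{R}\to\mathbb{R}$ of finite total variation, $\|\sigma\|_{BV}=\sup\sum_{i}|\sigma(x_{i+1})-\sigma(x_i)|<\infty$ over finite increasing sequences $(x_i)$ (integrability of $\sigma$ is not required). "Non-constant" means not almost everywhere equal to a constant. $\Sigma_d^n(\sigma)=\{x\mapsto\sum_{i=1}^n\beta_i\sigma(\omega_i\cdot x+b_i):\omega_i\in\mathbb{R}^d,\ b_i,\beta_i\in\mathbb{R}\}$. Fourier convention: $\hat f(\omega)=(2\pi)^{-d}\int_{\mathbb{R}^d} f(x)e^{-i\omega\cdot x}dx$, so that $f(x)=\int_{\mathbb{R}^d}e^{i\omega\cdot x}\hat f(\omega)d\omega$. The Barron norm of $f:\mathbb{R}^d\to\mathbb{R}$ is $\|f\|_{\mathcal{B}^s}=\int_{\mathbb{R}^d}(1+|\omega|)^s|\hat f(\omega)|\,d\omega$, and $\mathcal{B}^s=\{f:\|f\|_{\mathcal{B}^s}<\infty\}$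 (real-valued functions whose Fourier transform is a function with this integral finite). $|\Omega|$ is the Lebesgue measure of $\Omega$. *)

theory Defs
  imports "HOL-Analysis.Analysis"
begin

text \<open>
  The dimension \<open>d\<close> is a natural number rather than a type, so that a constant can be chosen
  before \<open>d\<close>.  A point of \<open>\<real>\<^sup>d\<close> is an extensional function \<open>nat \<Rightarrow> real\<close> with index
  set \<open>{..<d}\<close>, as in the library's finite product measures and product topologies.
\<close>

definition Rn :: "nat \<Rightarrow> (nat \<Rightarrow> real) set" where
  "Rn d = {..<d} \<rightarrow>\<^sub>E UNIV"

definition ip :: "nat \<Rightarrow> (nat \<Rightarrow> real) \<Rightarrow> (nat \<Rightarrow> real) \<Rightarrow> real" where
  "ip d x y = (\<Sum>i<d. x i * y i)"

definition enorm :: "nat \<Rightarrow> (nat \<Rightarrow> real) \<Rightarrow> real" where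
  "enorm d x = L2_set x {..<d}"

definition edist :: "nat \<Rightarrow> (nat \<Rightarrow> real) \<Rightarrow> (nat \<Rightarrow> real) \<Rightarrow> real" where
  "edist d x y = L2_set (\<lambda>i. x i - y i) {..<d}"

definition Rn_topology :: "nat \<Rightarrow> (nat \<Rightarrow> real) topology" where
  "Rn_topology d = product_topology (\<lambda>_. euclideanreal) {..<d}"

text \<open>Completing the product measure makes all Lebesgue (not only Borel) sets measurable.\<close>

definition leb :: "nat \<Rightarrow> (nat \<Rightarrow> real) measure" where
  "leb d = completion (\<Pi>\<^sub>M i\<in>{..<d}. lborel)"

definition bounded_domain :: "nat \<Rightarrow> (nat \<Rightarrow> real) set \<Rightarrow> bool" where
  "bounded_domain d \<Omega> \<longleftrightarrow>
     \<Omega> \<noteq> {} \<and> openin (Rn_topology d) \<Omega> \<and> connectedin (Rn_topology d) \<Omega> \<and>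
     (\<exists>B. \<forall>x\<in>\<Omega>. enorm d x \<le> B)"

text \<open>Only meaningful for nonempty bounded sets, since the supremum is taken in \<open>real\<close>.\<close>

definition diam :: "nat \<Rightarrow> (nat \<Rightarrow> real) set \<Rightarrow> real" where
  "diam d \<Omega> = (SUP (x, y)\<in>\<Omega> \<times> \<Omega>. edist d x y)"

definition total_variation :: "(real \<Rightarrow> real) \<Rightarrow> ennreal" where
  "total_variation \<sigma> =
     (SUP xs\<in>{xs. sorted_wrt (<) xs}.
        ennreal (\<Sum>i<length xs - 1. \<bar>\<sigma> (xs ! Suc i) - \<sigma> (xs ! i)\<bar>))"

definition BV :: "(real \<Rightarrow> real) set" where
  "BV = {\<sigma>. total_variation \<sigma> < \<infinity>}"

definition non_constant :: "(real \<Rightarrow> real) \<Rightarrow> bool" where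
  "non_constant \<sigma> \<longleftrightarrow> \<not> (\<exists>c. AE x in lebesgue. \<sigma> x = c)"

definition networks ::
    "nat \<Rightarrow> nat \<Rightarrow> (real \<Rightarrow> real) \<Rightarrow> ((nat \<Rightarrow> real) \<Rightarrow> real) set" where
  "networks d n \<sigma> =
     {(\<lambda>x. \<Sum>i<n. \<beta> i * \<sigma> (ip d (\<omega> i) x + b i)) | \<omega> b \<beta>. \<forall>i<n. \<omega> i \<in> Rn d}"

definition partial ::
    "nat \<Rightarrow> ((nat \<Rightarrow> real) \<Rightarrow> complex) \<Rightarrow> (nat \<Rightarrow> real) \<Rightarrow> complex" where
  "partial i \<phi> x = vector_derivative (\<lambda>t. \<phi> (x(i := t))) (at (x i))"

text \<open>
  Schwartz functions: the list \<open>is\<close> runs through all iterated partial derivatives.  Continuity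
  of the derivatives need not be demanded, because a function all of whose first-order partial
  derivatives exist and are bounded is Lipschitz.
\<close>

definition schwartz :: "nat \<Rightarrow> ((nat \<Rightarrow> real) \<Rightarrow> complex) set" where
  "schwartz d =
     {\<phi>. \<forall>is. set is \<subseteq> {..<d} \<longrightarrow>
        (\<forall>x\<in>Rn d. \<forall>i<d. (\<lambda>t. foldr partial is \<phi> (x(i := t))) differentiable (at (x i))) \<and>
        (\<forall>N::nat. \<exists>B. \<forall>x\<in>Rn d. (1 + enorm d x) ^ N * cmod (foldr partial is \<phi> x) \<le> B)}"

definition fourier_integral ::
    "nat \<Rightarrow> ((nat \<Rightarrow> real) \<Rightarrow> complex) \<Rightarrow> (nat \<Rightarrow> real) \<Rightarrow> complex" where
  "fourier_integral d \<phi> \<omega> =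
     complex_of_real (1 / (2 * pi) ^ d) * (LINT x|leb d. \<phi> x * exp (- \<i> * ip d \<omega> x))"

text \<open>
  Elements of a Barron space need not be integrable, so their Fourier transform is the one of
  tempered distributions: \<open>g\<close> is the Fourier transform of \<open>f\<close> iff
  \<open>\<integral> g \<phi> = \<integral> f \<phi>^\<close> for every Schwartz function \<open>\<phi>\<close>.
\<close>

definition tempered :: "nat \<Rightarrow> ((nat \<Rightarrow> real) \<Rightarrow> complex) \<Rightarrow> bool" where
  "tempered d f \<longleftrightarrow> f \<in> borel_measurable (leb d) \<and>
     (\<forall>\<phi>\<in>schwartz d. integrable (leb d) (\<lambda>x. f x * \<phi> x))"

definition has_fourier_transform ::
    "nat \<Rightarrow> ((nat \<Rightarrow> real) \<Rightarrow> complex) \<Rightarrow> ((nat \<Rightarrow> real) \<Rightarrow> complex) \<Rightarrow> bool" where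
  "has_fourier_transform d f g \<longleftrightarrow> tempered d f \<and> tempered d g \<and>
     (\<forall>\<phi>\<in>schwartz d.
        (LINT \<omega>|leb d. g \<omega> * \<phi> \<omega>) = (LINT x|leb d. f x * fourier_integral d \<phi> x))"

text \<open>If a Fourier transform exists as a function, it is unique up to null sets, so the choice
  below does not affect the integral in the Barron norm.\<close>

definition fourier_transform ::
    "nat \<Rightarrow> ((nat \<Rightarrow> real) \<Rightarrow> real) \<Rightarrow> (nat \<Rightarrow> real) \<Rightarrow> complex" where
  "fourier_transform d f = (SOME g. has_fourier_transform d (\<lambda>x. complex_of_real (f x)) g)"

definition barron_norm :: "nat \<Rightarrow> real \<Rightarrow> ((nat \<Rightarrow> real) \<Rightarrow> real) \<Rightarrow> ennreal" where
  "barron_norm d s f =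
     (\<integral>\<^sup>+\<omega>. ennreal ((1 + enorm d \<omega>) powr s * cmod (fourier_transform d f \<omega>)) \<partial>leb d)"

definition barron_space :: "nat \<Rightarrow> real \<Rightarrow> ((nat \<Rightarrow> real) \<Rightarrow> real) set" where
  "barron_space d s =
     {f. (\<exists>g. has_fourier_transform d (\<lambda>x. complex_of_real (f x)) g) \<and> barron_norm d s f < \<infinity>}"

definition L2_norm :: "nat \<Rightarrow> (nat \<Rightarrow> real) set \<Rightarrow> ((nat \<Rightarrow> real) \<Rightarrow> real) \<Rightarrow> ennreal" where
  "L2_norm d \<Omega> h =
     (let I = (\<integral>\<^sup>+x\<in>\<Omega>. ennreal ((h x)\<^sup>2) \<partial>leb d)
      in if I = \<infinity> then \<infinity> else ennreal (sqrt (enn2real I)))"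

end

theory Submission
  imports Defs "HOL-Probability.Probability"
begin

text \<open>
  Put \<open>\<eta> t = \<sigma> (t + 1) - \<sigma> t\<close> and let \<open>V\<close> be the variation function of \<open>\<sigma>\<close>.  Then
  \<open>\<bar>\<eta> (s + b)\<bar> \<le> V (b + L + 1) - V (b - L)\<close> for \<open>\<bar>s\<bar> \<le> L\<close>, and the integral of the right-hand side over
  \<open>b\<close> is at most \<open>(2 L + 1)\<close> times the total variation.  In particular \<open>\<eta>\<close> is integrable, and since
  \<open>\<sigma>\<close> is not constant, \<open>c = \<integral> \<eta> t exp (- \<i> a t) dt\<close> is nonzero for some \<open>a \<noteq> 0\<close>.
  Substituting \<open>exp (\<i> a s) = (1 / c) \<integral> \<eta> (s + b) exp (- \<i> a b) db\<close> with \<open>s = \<omega> \<cdot> (x - x0) / a\<close>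
  into Fourier inversion writes \<open>f\<close> on \<open>\<Omega>\<close> as an integral of neurons over \<open>(\<omega>, b)\<close>, dominated
  uniformly in \<open>x\<close> by a function whose integral is at most a constant times the Barron norm.
  Sampling \<open>(\<omega>, b)\<close> with this dominating density gives, by the variance bound, the rate \<open>n\<close> to the
  power \<open>-1/2\<close>, which is stronger than what is claimed.
\<close>

section \<open>Functions of bounded variation\<close>

text \<open>The obstacle is that \<sigma> need not decay: it is bounded but in general not
  integrable, so an exponential cannot be obtained by integrating its translates directly. Passing
  to the unit difference \<eta> buys integrability at the price of two neurons per sample. Frequency
  0 cannot serve, because the substitution divides by a; and the integral of \<eta> is 0 anyway
  whenever \<sigma> has the same limit at both ends of the line. Centring at a point x0 of \<Omega>
  gives |s| <= |\<omega>| diam(\<Omega>) / |a|, so the constant sees the diameter of \<Omega> but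
  not its position. For a given \<omega> the arguments of \<eta> then range over a window around b
  whose length is affine in |\<omega>|. Integrating the variation of \<sigma> over that window in b
  costs a multiple of 1 + |\<omega>|, which is the weight of the Barron norm with s = 1. Since f is
  only tempered, inversion has to be derived from the distributional definition. Gaussian test
  functions suffice for that, and their transforms are explicit.\<close>

lemma BV_variation_function:
  assumes "\<sigma> \<in> BV"
  obtains V :: "real \<Rightarrow> real" and T where "mono V" "\<And>t. 0 \<le> V t" "\<And>t. V t \<le> T"
    "\<And>x y. x \<le> y \<Longrightarrow> \<bar>\<sigma> y - \<sigma> x\<bar> \<le> V y - V x"
proof -
  define var where "var xs = (\<Sum>i<length xs - 1. \<bar>\<sigma> (xs ! Suc i) - \<sigma> (xs ! i)\<bar>)" for xs
  define A where "A t = {xs :: real list. sorted_wrt (<) xs \<and> set xs \<subseteq> {..t}}" for t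
  \<comment> \<open>\<open>V t\<close> is the variation of \<sigma> on the half-line up to
    \<open>t\<close>. The empty list keeps the supremum nonempty and makes \<open>V\<close>
    nonnegative.\<close>
  define V where "V t = (SUP xs\<in>A t. var xs)" for t
  obtain T where T: "0 \<le> T" "total_variation \<sigma> = ennreal T"
    using assms by (cases "total_variation \<sigma>") (auto simp: BV_def)
  have var_T: "var xs \<le> T" if "sorted_wrt (<) xs" for xs
  proof -
    have "ennreal (var xs) \<le> total_variation \<sigma>"
      unfolding total_variation_def var_def using that by (intro SUP_upper) auto
    then show ?thesis using T by simp
  qed
  have bdd: "bdd_above (var ` A t)" for t
    by (rule bdd_aboveI2[of _ _ T]) (auto simp: A_def intro: var_T)
  have Nil: "[] \<in> A t" for t by (simp add: A_def)
  have upper: "var xs \<le> V t" if "xs \<in> A t" for xs t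
    unfolding V_def using that bdd by (intro cSUP_upper) auto
  have snoc: "var (xs @ [y]) = var xs + \<bar>\<sigma> y - \<sigma> (last xs)\<bar>" if "xs \<noteq> []" for xs y
  proof -
    obtain m where m: "length xs = Suc m" using \<open>xs \<noteq> []\<close> by (cases "length xs") auto
    have "var (xs @ [y]) = (\<Sum>i<Suc m. \<bar>\<sigma> ((xs @ [y]) ! Suc i) - \<sigma> ((xs @ [y]) ! i)\<bar>)"
      by (simp add: var_def m)
    also have "\<dots> = (\<Sum>i<m. \<bar>\<sigma> (xs ! Suc i) - \<sigma> (xs ! i)\<bar>) + \<bar>\<sigma> y - \<sigma> (last xs)\<bar>"
      using m that by (simp add: nth_append last_conv_nth)
    finally show ?thesis by (simp add: var_def m)
  qed
  \<comment> \<open>Appending \<open>x\<close> and \<open>y\<close> to a list below \<open>x\<close>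
    loses no variation and gains the increment. Lists are strictly increasing, so \<open>x\<close>
    may be appended only if the list does not already end in it.\<close>
  have step: "var xs + \<bar>\<sigma> y - \<sigma> x\<bar> \<le> V y" if "x < y" "xs \<in> A x" for x y xs
  proof (cases "xs = []")
    case True
    have "var [x, y] \<le> V y" by (rule upper) (use that in \<open>auto simp: A_def\<close>)
    then show ?thesis by (simp add: True var_def)
  next
    case False
    show ?thesis
    proof (cases "last xs = x")
      case True
      have "var (xs @ [y]) \<le> V y"
        by (rule upper) (use that in \<open>force simp: A_def sorted_wrt_append\<close>)
      then show ?thesis by (simp add: snoc False True)
    next
      case ne: False
      have lt: "z < x" if "z \<in> set xs" for z
      proof -
        have "sorted_wrt (<) (butlast xs @ [last xs])" "z \<in> set (butlast xs @ [last xs])"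
          using \<open>xs \<in> A x\<close> that False by (auto simp: A_def)
        then have "z \<le> last xs"
          by (auto simp: sorted_wrt_append simp del: append_butlast_last_id)
        moreover have "last xs < x"
          using \<open>xs \<in> A x\<close> ne last_in_set[OF False] by (auto simp: A_def less_le)
        ultimately show ?thesis by simp
      qed
      have "var ((xs @ [x]) @ [y]) \<le> V y"
        by (rule upper) (use that lt in \<open>force simp: A_def sorted_wrt_append\<close>)
      moreover have "var xs \<le> var (xs @ [x])" by (simp add: snoc False)
      ultimately show ?thesis by (subst (asm) snoc) auto
    qed
  qed
  have main: "\<bar>\<sigma> y - \<sigma> x\<bar> \<le> V y - V x" if "x \<le> y" for x y
  proof (cases "x = y")
    case False
    have "V x \<le> V y - \<bar>\<sigma> y - \<sigma> x\<bar>"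
      unfolding V_def[of x] using Nil step[of x y] that False
      by (intro cSUP_least) (auto simp: algebra_simps less_le)
    then show ?thesis by simp
  qed auto
  show ?thesis
  proof (rule that[of V T])
    show "mono V" by (rule monoI) (use main in \<open>force dest: order_trans[OF abs_ge_zero]\<close>)
    show "0 \<le> V t" for t using upper[OF Nil, of t] by (simp add: var_def)
    show "V t \<le> T" for t
      unfolding V_def by (rule cSUP_least, use Nil in blast) (simp add: A_def var_T)
  qed (use main in auto)
qed

text \<open>Integrating \<open>V (b + l)\<close> over a window is integrating \<open>V\<close> over
  the window moved right by \<open>l\<close>. The gain is at most the strip of length
  \<open>l\<close> on the right, where \<open>V\<close> is at most \<open>T\<close>; the strip lost
  on the left only helps, as \<open>V\<close> is nonnegative.\<close>

lemma nn_integral_shift_increment_le: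
  fixes V :: "real \<Rightarrow> real"
  assumes V: "mono V" "\<And>t. 0 \<le> V t" "\<And>t. V t \<le> T" and "0 \<le> l"
  shows "(\<integral>\<^sup>+b. ennreal (V (b + l) - V b) \<partial>lborel) \<le> ennreal (l * T)"
proof -
  have [measurable]: "V \<in> borel_measurable borel" by (rule borel_measurable_mono) fact
  have T: "0 \<le> T" using V(2,3) order_trans by blast
  have *: "(\<integral>\<^sup>+b. ennreal (V (b + l) - V b) * indicator {-real N..<real N} b \<partial>lborel)
      \<le> ennreal (l * T)" for N :: nat
  proof -
    \<comment> \<open>Truncation to a bounded window makes this integral finite, which permits
      cancelling it in \<open>ennreal\<close> below.\<close>
    let ?I = "\<integral>\<^sup>+b. ennreal (V b) * indicator {-real N..<real N} b \<partial>lborel"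
    have fin: "?I \<le> ennreal (T * (2 * real N))"
    proof -
      have "?I \<le> (\<integral>\<^sup>+b. ennreal T * indicator {-real N..<real N} b \<partial>lborel)"
        by (intro nn_integral_mono) (auto simp: V split: split_indicator intro!: ennreal_leI)
      also have "\<dots> = ennreal (T * (2 * real N))"
        by (simp add: nn_integral_cmult_indicator ennreal_mult T)
      finally show ?thesis .
    qed
    have "(\<integral>\<^sup>+b. ennreal (V (b + l) - V b) * indicator {-real N..<real N} b \<partial>lborel) + ?I
        = (\<integral>\<^sup>+b. ennreal (V (b + l)) * indicator {-real N..<real N} b \<partial>lborel)"
      by (subst nn_integral_add[symmetric])
        (auto intro!: nn_integral_cong split: split_indicator
          simp: ennreal_plus[symmetric] monoD[OF V(1)] V \<open>0 \<le> l\<close> simp del: ennreal_plus)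
    also have "\<dots> = (\<integral>\<^sup>+b. ennreal (V b) * indicator {-real N..<real N} (b - l) \<partial>lborel)"
      by (subst (2) lborel_distr_plus[symmetric, of l], subst nn_integral_distr)
        (auto simp: add.commute)
    also have "\<dots> \<le> (\<integral>\<^sup>+b. ennreal (V b) * indicator {-real N..<real N} b
        + ennreal T * indicator {real N..<real N + l} b \<partial>lborel)"
      using \<open>0 \<le> l\<close> by (intro nn_integral_mono) (auto simp: V split: split_indicator intro!: ennreal_leI)
    also have "\<dots> = ?I + ennreal (l * T)"
      using \<open>0 \<le> l\<close> T by (subst nn_integral_add) (auto simp: nn_integral_cmult_indicator ennreal_mult mult.commute)
    finally have "?I + (\<integral>\<^sup>+b. ennreal (V (b + l) - V b) * indicator {-real N..<real N} b \<partial>lborel)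
        \<le> ?I + ennreal (l * T)" by (simp add: add.commute)
    moreover have "?I \<noteq> \<infinity>" using fin by (auto simp: top_unique)
    ultimately show ?thesis by (simp add: ennreal_add_left_cancel_le)
  qed
  have "(\<integral>\<^sup>+b. ennreal (V (b + l) - V b) \<partial>lborel)
      = (\<integral>\<^sup>+b. (SUP N. ennreal (V (b + l) - V b) * indicator {-real N..<real N} b) \<partial>lborel)"
  proof (intro nn_integral_cong)
    fix b :: real
    obtain N :: nat where N: "\<bar>b\<bar> < real N" using reals_Archimedean2 by blast
    show "ennreal (V (b + l) - V b) = (SUP N. ennreal (V (b + l) - V b) * indicator {-real N..<real N} b)"
      using N by (intro antisym SUP_upper2[of N] SUP_least) (auto split: split_indicator)
  qed
  also have "\<dots> = (SUP N. \<integral>\<^sup>+b. ennreal (V (b + l) - V b) * indicator {-real N..<real N} b \<partial>lborel)"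
    by (rule nn_integral_monotone_convergence_SUP)
      (auto simp: incseq_def le_fun_def split: split_indicator)
  also have "\<dots> \<le> ennreal (l * T)" by (rule SUP_least) (rule *)
  finally show ?thesis .
qed

section \<open>Uniqueness of Fourier transforms\<close>

text \<open>The positive and negative parts of \<open>h\<close>, pushed forward by \<open>X\<close>,
  have the same Fourier transform. Frequency 0 shows that they have equal mass \<open>m\<close>, so
  dividing by \<open>m\<close> gives two probability distributions and Levy's uniqueness theorem
  applies. Keeping \<open>M\<close> and \<open>X\<close> general allows \<open>X\<close> to be a
  single coordinate of a point of \<open>Rn d\<close>.\<close>

lemma fourier_uniqueness_real:
  fixes h :: "'a \<Rightarrow> real" and X :: "'a \<Rightarrow> real"
  assumes h[measurable]: "integrable M h" and X[measurable]: "X \<in> borel_measurable M"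
    and zero: "\<And>a. (LINT x|M. complex_of_real (h x) * exp (\<i> * complex_of_real (a * X x))) = 0"
    and B[measurable]: "B \<in> sets borel"
  shows "(LINT x|M. h x * indicator B (X x)) = 0"
proof -
  note [measurable] = borel_measurable_integrable[OF h]
  define p where "p s x = max 0 (s * h x)" for s x
  have [measurable]: "p s \<in> borel_measurable M" for s unfolding p_def by measurable
  have p_int: "integrable M (p s)" for s unfolding p_def by (intro integrable_max integrable_mult_right h integrable_zero)
  have p_nn: "0 \<le> p s x" for s x by (simp add: p_def)
  have h_eq: "h x = p 1 x - p (-1) x" for x by (simp add: p_def)
  define m where "m = (LINT x|M. p 1 x)"
  have bint: "integrable M (\<lambda>x. complex_of_real (p s x) * exp (\<i> * complex_of_real (a * X x)))" for s a
    by (rule Bochner_Integration.integrable_bound[OF p_int[of s]]) (auto simp: norm_mult p_nn)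
  have chars: "(LINT x|M. complex_of_real (p 1 x) * exp (\<i> * complex_of_real (a * X x)))
      = (LINT x|M. complex_of_real (p (-1) x) * exp (\<i> * complex_of_real (a * X x)))" for a
  proof -
    have "0 = (LINT x|M. complex_of_real (p 1 x) * exp (\<i> * complex_of_real (a * X x))
        - complex_of_real (p (-1) x) * exp (\<i> * complex_of_real (a * X x)))"
      using zero[of a] by (simp add: h_eq algebra_simps)
    then show ?thesis using bint by simp
  qed
  have m': "m = (LINT x|M. p (-1) x)"
    using chars[of 0] by (simp add: m_def)
  have m_s: "(LINT x|M. p s x) = m" if "s \<in> {1, -1}" for s using that m_def m' by auto
  have "m \<ge> 0" unfolding m_def by (simp add: p_nn)
  have ip_int: "integrable M (\<lambda>x. p s x * indicator B (X x))" for s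
    by (rule Bochner_Integration.integrable_bound[OF p_int[of s]]) (auto simp: p_nn split: split_indicator)
  define D where "D s = distr (density M (\<lambda>x. ennreal (p s x / m))) borel X" for s
  have "(LINT x|M. p 1 x * indicator B (X x)) = (LINT x|M. p (-1) x * indicator B (X x))"
  \<comment> \<open>For \<open>m = 0\<close> there is nothing to normalise, but both parts then
    vanish almost everywhere.\<close>
  proof (cases "m = 0")
    case True
    have z: "AE x in M. p s x = 0" if "s \<in> {1, -1}" for s
      using m_s[OF that] True integral_nonneg_eq_0_iff_AE[OF p_int[of s]] p_nn by auto
    have "(LINT x|M. p s x * indicator B (X x)) = 0" if "s \<in> {1, -1}" for s
    proof -
      have "(LINT x|M. p s x * indicator B (X x)) = (LINT x|M. 0)"
        by (rule integral_cong_AE) (use z[OF that] in auto)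
      then show ?thesis by simp
    qed
    then show ?thesis by simp
  next
    case False
    then have "m > 0" using \<open>m \<ge> 0\<close> by simp
    have rd: "real_distribution (D s)" if "s \<in> {1, -1}" for s
    proof -
      have "emeasure (density M (\<lambda>x. ennreal (p s x / m))) (space M) = 1"
        using m_s[OF that] \<open>m > 0\<close> p_int[of s] p_nn
        by (simp add: emeasure_density nn_integral_eq_integral cong: nn_integral_cong_simp)
      then interpret prob_space "density M (\<lambda>x. ennreal (p s x / m))"
        by (intro prob_spaceI) simp
      show ?thesis unfolding D_def by (rule real_distribution_distr) simp
    qed
    have chr: "char (D s) a = (LINT x|M. complex_of_real (p s x) * exp (\<i> * complex_of_real (a * X x))) / m" for s a
      unfolding char_def D_def using \<open>m > 0\<close> p_nn
      by (subst integral_distr, simp, simp, subst integral_density)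
        (auto simp: scaleR_conv_of_real)
    have "D 1 = D (-1)"
      by (rule Levy_uniqueness) (use rd chars in \<open>auto simp: chr fun_eq_iff\<close>)
    moreover have "measure (D s) B = (LINT x|M. p s x * indicator B (X x)) / m" for s
    proof -
      have "emeasure (D s) B = (\<integral>\<^sup>+x. ennreal (p s x / m) * indicator (X -` B \<inter> space M) x \<partial>M)"
        by (simp add: D_def emeasure_distr emeasure_density)
      also have "\<dots> = (\<integral>\<^sup>+x. ennreal (p s x * indicator B (X x) / m) \<partial>M)"
        by (intro nn_integral_cong) (auto split: split_indicator)
      also have "\<dots> = ennreal ((LINT x|M. p s x * indicator B (X x)) / m)"
        using \<open>m > 0\<close> p_nn ip_int[of s] by (subst nn_integral_eq_integral) auto
      finally have "emeasure (D s) B = ennreal ((LINT x|M. p s x * indicator B (X x)) / m)" .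
      then show ?thesis using \<open>m > 0\<close> p_nn
        by (simp add: measure_def)
    qed
    ultimately show ?thesis using \<open>m > 0\<close> by (metis divide_cancel_right less_irrefl)
  qed
  then show ?thesis
    using ip_int by (simp add: h_eq left_diff_distrib)
qed

text \<open>Conjugating the hypothesis at \<open>- a\<close> shows that it also holds for the
  conjugate of \<open>h\<close>. It therefore passes to the real and imaginary parts.\<close>

lemma fourier_uniqueness:
  fixes h :: "'a \<Rightarrow> complex" and X :: "'a \<Rightarrow> real"
  assumes h: "integrable M h" and X[measurable]: "X \<in> borel_measurable M"
    and zero: "\<And>a. (LINT x|M. h x * exp (\<i> * complex_of_real (a * X x))) = 0"
    and B[measurable]: "B \<in> sets borel"
  shows "(LINT x|M. h x * indicator B (X x)) = 0"
proof -
  note [measurable] = borel_measurable_integrable[OF h]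
    borel_measurable_integrable[OF integrable_cnj[OF h]]
  have int: "integrable M (\<lambda>x. h x * exp (\<i> * complex_of_real (a * X x)))" for a
    by (rule Bochner_Integration.integrable_bound[OF h]) (auto simp: norm_mult)
  have int': "integrable M (\<lambda>x. cnj (h x) * exp (\<i> * complex_of_real (a * X x)))" for a
    by (rule Bochner_Integration.integrable_bound[OF h]) (auto simp: norm_mult)
  have zero': "(LINT x|M. cnj (h x) * exp (\<i> * complex_of_real (a * X x))) = 0" for a
  proof -
    have "(LINT x|M. cnj (h x) * exp (\<i> * complex_of_real (a * X x)))
        = cnj (LINT x|M. h x * exp (\<i> * complex_of_real (- a * X x)))"
      by (subst Bochner_Integration.integral_cnj[symmetric]) (simp add: exp_cnj)
    then show ?thesis by (simp add: zero[of "-a", simplified])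
  qed
  have re: "(LINT x|M. Re (h x) * indicator B (X x)) = 0"
  proof (rule fourier_uniqueness_real)
    fix a
    have "(LINT x|M. complex_of_real (Re (h x)) * exp (\<i> * complex_of_real (a * X x)))
      = (LINT x|M. (h x * exp (\<i> * complex_of_real (a * X x))
           + cnj (h x) * exp (\<i> * complex_of_real (a * X x))) / 2)"
      by (intro Bochner_Integration.integral_cong) (auto simp: complex_add_cnj distrib_right[symmetric])
    also have "\<dots> = 0" using int zero zero' int' by simp
    finally show "(LINT x|M. complex_of_real (Re (h x)) * exp (\<i> * complex_of_real (a * X x))) = 0" .
  qed (use h in auto)
  have im: "(LINT x|M. Im (h x) * indicator B (X x)) = 0"
  proof (rule fourier_uniqueness_real)
    fix a
    have "(LINT x|M. complex_of_real (Im (h x)) * exp (\<i> * complex_of_real (a * X x)))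
      = (LINT x|M. (h x * exp (\<i> * complex_of_real (a * X x))
           - cnj (h x) * exp (\<i> * complex_of_real (a * X x))) / (2 * \<i>))"
    proof (intro Bochner_Integration.integral_cong refl)
      fix x
      have "h x * w - cnj (h x) * w = 2 * \<i> * (complex_of_real (Im (h x)) * w)" for w
        by (subst left_diff_distrib[symmetric]) (simp add: complex_diff_cnj)
      then show "complex_of_real (Im (h x)) * exp (\<i> * complex_of_real (a * X x))
        = (h x * exp (\<i> * complex_of_real (a * X x))
           - cnj (h x) * exp (\<i> * complex_of_real (a * X x))) / (2 * \<i>)" by simp
    qed
    also have "\<dots> = 0" using int zero zero' int' by simp
    finally show "(LINT x|M. complex_of_real (Im (h x)) * exp (\<i> * complex_of_real (a * X x))) = 0" .
  qed (use h in auto)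
  have i: "integrable M (\<lambda>x. h x * indicator B (X x))"
    by (rule Bochner_Integration.integrable_bound[OF h]) (auto simp: norm_mult split: split_indicator)
  have "Re (LINT x|M. h x * indicator B (X x)) = (LINT x|M. Re (h x) * indicator B (X x))"
    unfolding integral_Re[OF i, symmetric]
    by (intro Bochner_Integration.integral_cong) (auto split: split_indicator)
  moreover have "Im (LINT x|M. h x * indicator B (X x)) = (LINT x|M. Im (h x) * indicator B (X x))"
    unfolding integral_Im[OF i, symmetric]
    by (intro Bochner_Integration.integral_cong) (auto split: split_indicator)
  ultimately show ?thesis using re im by (simp add: complex_eq_iff)
qed

lemma AE_zero_if_set_integrals_zero:
  fixes h :: "'a \<Rightarrow> complex"
  assumes h: "integrable M h"
    and zero: "\<And>B. B \<in> sets M \<Longrightarrow> (LINT x|M. h x * indicator B x) = 0"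
  shows "AE x in M. h x = 0"
proof -
  note [measurable] = borel_measurable_integrable[OF h]
  have i: "integrable M (\<lambda>x. h x * indicator B x)" if [measurable]: "B \<in> sets M" for B
    by (rule Bochner_Integration.integrable_bound[OF h]) (auto simp: norm_mult split: split_indicator)
  have "AE x in M. Re (h x) = 0"
  proof (rule density_unique_real)
    fix B assume B: "B \<in> sets M"
    have "(LINT x|M. Re (h x * indicator B x)) = 0"
      by (subst integral_Re) (simp_all add: i zero B)
    moreover have "(LINT x|M. Re (h x * indicator B x)) = (LINT x:B|M. Re (h x))"
      unfolding set_lebesgue_integral_def by (intro Bochner_Integration.integral_cong) (auto split: split_indicator)
    ultimately show "(LINT x:B|M. Re (h x)) = (LINT x:B|M. 0)"
      by (simp add: set_lebesgue_integral_def)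
  qed (use h in auto)
  moreover have "AE x in M. Im (h x) = 0"
  proof (rule density_unique_real)
    fix B assume B: "B \<in> sets M"
    have "(LINT x|M. Im (h x * indicator B x)) = 0"
      by (subst integral_Im) (simp_all add: i zero B)
    moreover have "(LINT x|M. Im (h x * indicator B x)) = (LINT x:B|M. Im (h x))"
      unfolding set_lebesgue_integral_def by (intro Bochner_Integration.integral_cong) (auto split: split_indicator)
    ultimately show "(LINT x:B|M. Im (h x)) = (LINT x:B|M. 0)"
      by (simp add: set_lebesgue_integral_def)
  qed (use h in auto)
  ultimately show ?thesis by eventually_elim (simp add: complex_eq_iff)
qed

lemma fourier_uniqueness_lborel:
  fixes h :: "real \<Rightarrow> complex"
  assumes h: "integrable lborel h"
    and zero: "\<And>a. (LINT x|lborel. h x * exp (\<i> * complex_of_real (a * x))) = 0"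
  shows "AE x in lborel. h x = 0"
  using AE_zero_if_set_integrals_zero[OF h] fourier_uniqueness[OF h, of "\<lambda>x. x"] zero by simp

section \<open>Lebesgue measure in dimension d and uniqueness of Fourier transforms there\<close>

lemma space_leb: "space (leb d) = Rn d"
  by (simp add: leb_def Rn_def space_PiM)

lemma measurable_lebI: "f \<in> measurable (\<Pi>\<^sub>M i\<in>{..<d}. lborel) N \<Longrightarrow> f \<in> measurable (leb d) N"
  unfolding leb_def by (rule measurable_completion)

lemma measurable_component_leb [measurable (raw)]:
  "i < d \<Longrightarrow> (\<lambda>x. x i) \<in> borel_measurable (leb d)"
  by (rule measurable_lebI) measurable

lemma measurable_ip_leb [measurable (raw)]:
  assumes "f \<in> measurable M (leb d)" "g \<in> measurable M (leb d)"
  shows "(\<lambda>x. ip d (f x) (g x)) \<in> borel_measurable M"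
  unfolding ip_def
  by (intro borel_measurable_sum borel_measurable_times)
    (auto intro!: measurable_compose[OF assms(1)] measurable_compose[OF assms(2)])

interpretation product_sigma_finite_lborel: product_sigma_finite "\<lambda>_::nat. lborel :: real measure"
  by unfold_locales

lemma sigma_finite_leb: "sigma_finite_measure (leb d)"
proof -
  interpret finite_product_sigma_finite "\<lambda>_::nat. lborel :: real measure" "{..<d}"
    by unfold_locales simp
  obtain A where A: "countable A" "A \<subseteq> sets (\<Pi>\<^sub>M i\<in>{..<d}. (lborel :: real measure))"
    "\<Union>A = space (\<Pi>\<^sub>M i\<in>{..<d}. (lborel :: real measure))"
    "\<forall>a\<in>A. emeasure (\<Pi>\<^sub>M i\<in>{..<d}. (lborel :: real measure)) a \<noteq> \<infinity>"
    using sigma_finite_countable by blast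
  show ?thesis
    by unfold_locales (use A in \<open>auto simp: leb_def intro!: exI[of _ A]\<close>)
qed

text \<open>
  Coordinate by coordinate, the one-dimensional uniqueness turns exponentials into indicators of
  Borel sets, until only indicators of boxes are left.
\<close>

lemma fourier_uniqueness_leb:
  fixes h :: "(nat \<Rightarrow> real) \<Rightarrow> complex"
  assumes h: "integrable (leb d) h"
    and zero: "\<And>a. (LINT x|leb d. h x * exp (\<i> * complex_of_real (ip d a x))) = 0"
  shows "AE x in leb d. h x = 0"
proof -
  let ?P = "\<Pi>\<^sub>M i\<in>{..<d}. (lborel :: real measure)"
  note [measurable] = borel_measurable_integrable[OF h]
  have coord: "(LINT x|leb d. h x * (\<Prod>i\<in>S. indicator (A i) (x i)) *
      exp (\<i> * complex_of_real (\<Sum>i\<in>{..<d} - S. a i * x i))) = 0"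
    if "finite S" "S \<subseteq> {..<d}" "\<And>i. i \<in> S \<Longrightarrow> A i \<in> sets borel" for S a and A :: "nat \<Rightarrow> real set"
    using that
  proof (induction S arbitrary: a)
    case empty
    then show ?case using zero[of a] by (simp add: ip_def)
  next
    case (insert k S)
    have k: "k < d" and S: "S \<subseteq> {..<d}" using insert.prems by auto
    \<comment> \<open>\<open>h'\<close> is the integrand without the exponential in coordinate
      \<open>k\<close>. The induction hypothesis is available for every value \<open>t\<close> of
      the k-th frequency, so the transform of \<open>h'\<close> along that coordinate vanishes and
      the exponential can be traded for an indicator.\<close>
    define h' where "h' x = h x * (\<Prod>i\<in>S. indicator (A i) (x i)) *
      exp (\<i> * complex_of_real (\<Sum>i\<in>{..<d} - insert k S. a i * x i))" for x
    have int: "integrable (leb d) h'"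
    proof (rule Bochner_Integration.integrable_bound[OF h])
      have "(\<lambda>x. indicator (A i) (x i) :: complex) \<in> borel_measurable (leb d)" if "i \<in> S" for i
        using that S insert.prems by (intro measurable_compose[OF measurable_component_leb]) auto
      moreover have "(\<lambda>x. a i * x i) \<in> borel_measurable (leb d)" if "i \<in> {..<d} - insert k S" for i
        using that by (intro borel_measurable_times borel_measurable_const measurable_component_leb) auto
      ultimately show "h' \<in> borel_measurable (leb d)"
        unfolding h'_def
        by (intro borel_measurable_times borel_measurable_prod borel_measurable_exp
            borel_measurable_of_real borel_measurable_sum) auto
      have "norm (\<Prod>i\<in>S. indicator (A i) (x i) :: complex) \<le> 1" for x
        unfolding prod_norm[symmetric] by (intro prod_le_1) (auto simp: indicator_def)
      then show "AE x in leb d. norm (h' x) \<le> norm (h x)"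
        by (simp add: h'_def norm_mult mult_left_le)
    qed
    have "(LINT x|leb d. h' x * exp (\<i> * complex_of_real (t * x k))) = 0" for t
    proof -
      have "(LINT x|leb d. h' x * exp (\<i> * complex_of_real (t * x k))) =
        (LINT x|leb d. h x * (\<Prod>i\<in>S. indicator (A i) (x i)) *
          exp (\<i> * complex_of_real (\<Sum>i\<in>{..<d} - S. (a(k := t)) i * x i)))"
      proof (intro Bochner_Integration.integral_cong refl)
        fix x
        have eq: "{..<d} - S = insert k ({..<d} - insert k S)" using k insert.hyps by auto
        have "(\<Sum>i\<in>{..<d} - S. (a(k := t)) i * x i) = t * x k + (\<Sum>i\<in>{..<d} - insert k S. (a(k := t)) i * x i)"
          unfolding eq by (subst sum.insert) auto
        also have "(\<Sum>i\<in>{..<d} - insert k S. (a(k := t)) i * x i) = (\<Sum>i\<in>{..<d} - insert k S. a i * x i)"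
          by (intro sum.cong) auto
        finally show "h' x * exp (\<i> * complex_of_real (t * x k)) =
          h x * (\<Prod>i\<in>S. indicator (A i) (x i)) *
          exp (\<i> * complex_of_real (\<Sum>i\<in>{..<d} - S. (a(k := t)) i * x i))"
          by (simp add: h'_def exp_add[symmetric] algebra_simps)
      qed
      also have "\<dots> = 0" by (rule insert.IH) (use S insert.prems in auto)
      finally show ?thesis .
    qed
    from fourier_uniqueness[OF int _ this, of "A k"] k insert.prems
    have "(LINT x|leb d. h' x * indicator (A k) (x k)) = 0" by simp
    then show ?case using insert.hyps by (simp add: h'_def ac_simps)
  qed
  have box: "(LINT x|leb d. h x * indicator (Pi\<^sub>E {..<d} A) x) = 0"
    if "\<And>i. i < d \<Longrightarrow> A i \<in> sets borel" for A :: "nat \<Rightarrow> real set"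
  proof -
    have "(LINT x|leb d. h x * indicator (Pi\<^sub>E {..<d} A) x) =
      (LINT x|leb d. h x * (\<Prod>i\<in>{..<d}. indicator (A i) (x i)))"
    proof (intro Bochner_Integration.integral_cong refl)
      fix x assume "x \<in> space (leb d)"
      then have "x \<in> Pi\<^sub>E {..<d} A \<longleftrightarrow> (\<forall>i<d. x i \<in> A i)"
        by (auto simp: space_leb Rn_def PiE_iff)
      moreover have "(\<Prod>i\<in>{..<d}. indicator (A i) (x i)) = (if \<forall>i<d. x i \<in> A i then 1 else 0 :: complex)"
        by (auto simp: indicator_def prod_zero_iff intro!: prod.neutral)
      ultimately show "h x * indicator (Pi\<^sub>E {..<d} A) x = h x * (\<Prod>i\<in>{..<d}. indicator (A i) (x i))"
        by (simp add: indicator_def)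
    qed
    then show ?thesis using coord[of "{..<d}" A] that by simp
  qed
  have int: "integrable (leb d) (\<lambda>x. h x * indicator B x)" if [measurable]: "B \<in> sets (leb d)" for B
    by (rule Bochner_Integration.integrable_bound[OF h]) (auto simp: norm_mult split: split_indicator)
  have sub: "B \<in> sets ?P \<Longrightarrow> B \<in> sets (leb d)" for B
    unfolding leb_def by (rule sets_completionI_sets)
  have all: "(LINT x|leb d. h x * indicator B x) = 0" if "B \<in> sets ?P" for B
  proof -
    have gen: "sets ?P = sigma_sets (Rn d) (prod_algebra {..<d} (\<lambda>_. lborel))"
      by (simp add: sets_PiM Rn_def)
    have pow: "prod_algebra {..<d} (\<lambda>_. lborel) \<subseteq> Pow (Rn d)"
      using prod_algebra_sets_into_space[of "{..<d}" "\<lambda>_. lborel :: real measure"] by (simp add: Rn_def)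
    \<comment> \<open>Boxes are stable under intersection and generate the product sigma-algebra,
      and the sets over which \<open>h\<close> integrates to 0 form a Dynkin system.\<close>
    from Int_stable_prod_algebra pow that[unfolded gen] show ?thesis
    proof (induction rule: sigma_sets_induct_disjoint)
      case (basic B)
      then obtain A where "B = Pi\<^sub>E {..<d} A" "A \<in> (\<Pi> i\<in>{..<d}. sets lborel)"
        by (auto simp: prod_algebra_eq_finite)
      then show ?case using box[of A] by auto
    next
      case empty
      then show ?case by simp
    next
      case (compl B)
      have B: "B \<in> sets (leb d)" using compl(1) gen sub by simp
      have "Rn d = Pi\<^sub>E {..<d} (\<lambda>_. UNIV)" by (simp add: Rn_def)
      then have "(LINT x|leb d. h x * indicator (Rn d) x) = 0" using box[of "\<lambda>_. UNIV"] by simp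
      moreover have "(LINT x|leb d. h x * indicator (Rn d - B) x) =
        (LINT x|leb d. h x * indicator (Rn d) x - h x * indicator B x)"
        using sets.sets_into_space[OF B]
        by (intro Bochner_Integration.integral_cong) (auto simp: space_leb split: split_indicator)
      moreover have "Rn d \<in> sets (leb d)" using sets.top[of "leb d"] by (simp add: space_leb)
      ultimately show ?case using compl int B by simp
    next
      case (union F)
      have F: "F i \<in> sets (leb d)" for i using union gen sub by auto
      have "(LINT x:(\<Union>i. F i)|leb d. h x) = (\<Sum>i. LINT x:F i|leb d. h x)"
        using union(1) F int[of "\<Union>i. F i"]
        by (intro lebesgue_integral_countable_add)
          (auto simp: disjoint_family_on_def set_integrable_def scaleR_conv_of_real mult.commute of_real_indicator)
      then show ?case using union.IH
        by (simp add: set_lebesgue_integral_def scaleR_conv_of_real mult.commute of_real_indicator)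
    qed
  qed
  \<comment> \<open>Since \<open>leb\<close> is a completion, every measurable set agrees with a
    product-measurable one outside a null set.\<close>
  have "(LINT x|leb d. h x * indicator B x) = 0" if "B \<in> sets (leb d)" for B
  proof -
    from that[unfolded leb_def] obtain S N N' where
      N: "B = S \<union> N" "N \<subseteq> N'" "N' \<in> null_sets ?P" "S \<in> sets ?P"
      by (rule sets_completionE)
    have "AE x in ?P. x \<notin> N'" using N(3) by (rule AE_not_in)
    then have "AE x in leb d. x \<notin> N'" unfolding leb_def by (rule AE_completion)
    then have "AE x in leb d. h x * indicator B x = h x * indicator S x"
      by eventually_elim (use N in \<open>auto split: split_indicator\<close>)
    then have "(LINT x|leb d. h x * indicator B x) = (LINT x|leb d. h x * indicator S x)"
      by (rule integral_cong_AE[rotated 2]) (use that sub[OF N(4)] in measurable)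
    then show ?thesis using all N(4) by simp
  qed
  then show ?thesis by (rule AE_zero_if_set_integrals_zero[OF h])
qed

section \<open>Gaussian test functions and Fourier inversion\<close>

text \<open>A class that contains the Gaussians and is stable under \<open>partial\<close>, so that
  membership in \<open>schwartz\<close> needs no formula for iterated derivatives. One polynomial
  per coordinate is enough: differentiating in x_i alters only the i-th factor, replacing the
  polynomial p_i by its derivative minus (x_i - a_i) p_i.\<close>

definition gauss_poly :: "nat \<Rightarrow> (nat \<Rightarrow> real) \<Rightarrow> (nat \<Rightarrow> real poly) \<Rightarrow> (nat \<Rightarrow> real) \<Rightarrow> complex" where
  "gauss_poly d a p x = complex_of_real (\<Prod>j<d. poly (p j) (x j) * exp (- (x j - a j)\<^sup>2 / 2))"

lemma gauss_poly_has_partial: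
  assumes i: "i < d"
  shows "((\<lambda>t. gauss_poly d a p (x(i := t))) has_vector_derivative
    gauss_poly d a (p(i := pderiv (p i) - [:- a i, 1:] * p i)) x) (at (x i))"
proof -
  define R where "R = (\<Prod>j\<in>{..<d} - {i}. poly (p j) (x j) * exp (- (x j - a j)\<^sup>2 / 2))"
  have *: "gauss_poly d a p (x(i := t)) =
      complex_of_real (poly (p i) t * exp (- (t - a i)\<^sup>2 / 2) * R)" for t
    using i by (simp add: gauss_poly_def R_def prod.remove[of "{..<d}" i])
  have "((\<lambda>t. poly (p i) t * exp (- (t - a i)\<^sup>2 / 2) * R) has_real_derivative
      (poly (pderiv (p i)) (x i) - (x i - a i) * poly (p i) (x i)) * exp (- (x i - a i)\<^sup>2 / 2) * R) (at (x i))"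
    by (auto intro!: derivative_eq_intros poly_DERIV simp: field_simps)
  then have "((\<lambda>t. complex_of_real (poly (p i) t * exp (- (t - a i)\<^sup>2 / 2) * R)) has_vector_derivative
      complex_of_real ((poly (pderiv (p i)) (x i) - (x i - a i) * poly (p i) (x i)) * exp (- (x i - a i)\<^sup>2 / 2) * R)) (at (x i))"
    by (intro has_vector_derivative_of_real) (simp add: has_real_derivative_iff_has_vector_derivative)
  moreover have "gauss_poly d a (p(i := pderiv (p i) - [:- a i, 1:] * p i)) x =
      complex_of_real ((poly (pderiv (p i)) (x i) - (x i - a i) * poly (p i) (x i)) * exp (- (x i - a i)\<^sup>2 / 2) * R)"
    using i by (simp add: gauss_poly_def R_def prod.remove[of "{..<d}" i] algebra_simps)
  ultimately show ?thesis unfolding * by simp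
qed

lemma foldr_partial_gauss_poly:
  "set is \<subseteq> {..<d} \<Longrightarrow> \<exists>q. foldr partial is (gauss_poly d a p) = gauss_poly d a q"
proof (induction "is")
  case (Cons i "is")
  then obtain q where q: "foldr partial is (gauss_poly d a p) = gauss_poly d a q" by auto
  have "partial i (gauss_poly d a q) = gauss_poly d a (q(i := pderiv (q i) - [:- a i, 1:] * q i))"
    unfolding partial_def
    by (rule ext, rule vector_derivative_at, rule gauss_poly_has_partial) (use Cons.prems in auto)
  then show ?case using q by auto
qed auto

text \<open>With s = |t - a|, the power is at most a constant times (1 + s)^N. Comparison with a
  single term of the exponential series bounds (1 + s)^N by N! exp (1 + s), and the Gaussian
  exponent - s^2 / 2 beats 1 + s.\<close>

lemma power_times_gaussian_bounded: "\<exists>B. \<forall>t::real. (1 + \<bar>t\<bar>) ^ N * exp (- (t - a)\<^sup>2 / 2) \<le> B"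
proof (intro exI allI)
  fix t :: real
  define s where "s = \<bar>t - a\<bar>"
  have s: "s \<ge> 0" by (simp add: s_def)
  have "1 + \<bar>t\<bar> \<le> 1 + \<bar>a\<bar> + s" by (simp add: s_def)
  also have "\<dots> \<le> (1 + \<bar>a\<bar>) * (1 + s)" using s by (simp add: algebra_simps)
  finally have "(1 + \<bar>t\<bar>) ^ N \<le> (1 + \<bar>a\<bar>) ^ N * (1 + s) ^ N"
    by (simp add: power_mono flip: power_mult_distrib)
  also have "(1 + s) ^ N \<le> fact N * exp (1 + s)"
  proof -
    have "(1 + s) ^ N / fact N = (\<Sum>n\<in>{N}. (1 + s) ^ n /\<^sub>R fact n)" by (simp add: field_simps)
    also have "\<dots> \<le> exp (1 + s)"
      unfolding exp_def using s summable_exp_generic[of "1 + s"] by (intro sum_le_suminf) auto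
    finally show ?thesis by (simp add: field_simps)
  qed
  finally have "(1 + \<bar>t\<bar>) ^ N * exp (- (t - a)\<^sup>2 / 2) \<le>
      ((1 + \<bar>a\<bar>) ^ N * (fact N * exp (1 + s))) * exp (- (t - a)\<^sup>2 / 2)"
    by (simp add: mult_left_mono)
  also have "\<dots> = (1 + \<bar>a\<bar>) ^ N * fact N * exp (1 + s - s\<^sup>2 / 2)"
    by (simp add: s_def mult.assoc flip: exp_add)
  \<comment> \<open>The gap 3/2 - (1 + s - s^2 / 2) is the square (s - 1)^2 / 2.\<close>
  also have "1 + s - s\<^sup>2 / 2 \<le> 3 / 2"
    using zero_le_power2[of "s - 1"] by (simp add: power2_diff)
  finally show "(1 + \<bar>t\<bar>) ^ N * exp (- (t - a)\<^sup>2 / 2) \<le> (1 + \<bar>a\<bar>) ^ N * fact N * exp (3 / 2)"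
    by (simp add: mult_left_mono)
qed

text \<open>Each multiplication by \<open>t\<close> in Horner's scheme costs one power of 1 + |t|,
  so the induction keeps \<open>N\<close> arbitrary and calls its hypothesis at
  \<open>Suc N\<close>.\<close>

lemma poly_times_gaussian_bounded:
  "\<exists>B. \<forall>t::real. (1 + \<bar>t\<bar>) ^ N * \<bar>poly p t * exp (- (t - a)\<^sup>2 / 2)\<bar> \<le> B"
proof (induction p arbitrary: N)
  case 0
  then show ?case by (auto intro: exI[of _ 0])
next
  case (pCons c p)
  obtain B1 where B1: "(1 + \<bar>t\<bar>) ^ N * exp (- (t - a)\<^sup>2 / 2) \<le> B1" for t :: real
    using power_times_gaussian_bounded by blast
  obtain B2 where B2: "(1 + \<bar>t\<bar>) ^ Suc N * \<bar>poly p t * exp (- (t - a)\<^sup>2 / 2)\<bar> \<le> B2" for t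
    using pCons.IH by blast
  have "(1 + \<bar>t\<bar>) ^ N * \<bar>poly (pCons c p) t * exp (- (t - a)\<^sup>2 / 2)\<bar> \<le> \<bar>c\<bar> * B1 + B2" for t
  proof -
    have "\<bar>poly (pCons c p) t\<bar> \<le> \<bar>c\<bar> + (1 + \<bar>t\<bar>) * \<bar>poly p t\<bar>"
      by (rule order_trans[OF _ add_left_mono[of "\<bar>t\<bar> * \<bar>poly p t\<bar>"]])
        (auto simp: abs_mult[symmetric] algebra_simps)
    then have "(1 + \<bar>t\<bar>) ^ N * exp (- (t - a)\<^sup>2 / 2) * \<bar>poly (pCons c p) t\<bar> \<le>
      (1 + \<bar>t\<bar>) ^ N * exp (- (t - a)\<^sup>2 / 2) * (\<bar>c\<bar> + (1 + \<bar>t\<bar>) * \<bar>poly p t\<bar>)"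
      by (intro mult_left_mono) auto
    also have "\<dots> = \<bar>c\<bar> * ((1 + \<bar>t\<bar>) ^ N * exp (- (t - a)\<^sup>2 / 2)) +
        (1 + \<bar>t\<bar>) ^ Suc N * \<bar>poly p t * exp (- (t - a)\<^sup>2 / 2)\<bar>"
      by (simp add: abs_mult algebra_simps)
    also have "\<dots> \<le> \<bar>c\<bar> * B1 + B2"
      by (intro add_mono mult_left_mono B1 B2) auto
    finally show ?thesis by (simp add: abs_mult ac_simps)
  qed
  then show ?case by blast
qed

text \<open>Splits the weight in the Schwartz bounds into one factor per coordinate, to match the
  product form of \<open>gauss_poly\<close>. The Euclidean norm is at most the sum of the absolute
  values, and expanding the product gives 1 plus that sum plus nonnegative terms.\<close>

lemma one_plus_enorm_le_prod: "1 + enorm d x \<le> (\<Prod>j<d. 1 + \<bar>x j\<bar>)"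
proof -
  have "enorm d x \<le> (\<Sum>j<d. \<bar>x j\<bar>)"
    unfolding enorm_def by (rule L2_set_le_sum_abs)
  moreover have "1 + (\<Sum>j<d. \<bar>x j\<bar>) \<le> (\<Prod>j<d. 1 + \<bar>x j\<bar>)"
  proof (induction d)
    case (Suc d)
    have "1 + (\<Sum>j<Suc d. \<bar>x j\<bar>) \<le> (1 + (\<Sum>j<d. \<bar>x j\<bar>)) * (1 + \<bar>x d\<bar>)"
      by (simp add: algebra_simps sum_nonneg)
    also have "\<dots> \<le> (\<Prod>j<d. 1 + \<bar>x j\<bar>) * (1 + \<bar>x d\<bar>)"
      using Suc by (intro mult_right_mono) auto
    finally show ?case by simp
  qed simp
  ultimately show ?thesis by simp
qed

lemma gauss_poly_schwartz: "gauss_poly d a p \<in> schwartz d"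
proof -
  have bound: "\<exists>B. \<forall>x\<in>Rn d. (1 + enorm d x) ^ N * cmod (gauss_poly d a q x) \<le> B" for N q
  proof -
    obtain B where B: "(1 + \<bar>t\<bar>) ^ N * \<bar>poly (q j) t * exp (- (t - a j)\<^sup>2 / 2)\<bar> \<le> B j" for j t
    proof -
      have "\<forall>j. \<exists>B. \<forall>t. (1 + \<bar>t\<bar>) ^ N * \<bar>poly (q j) t * exp (- (t - a j)\<^sup>2 / 2)\<bar> \<le> B"
        using poly_times_gaussian_bounded by blast
      from choice[OF this] show ?thesis using that by blast
    qed
    have "(1 + enorm d x) ^ N * cmod (gauss_poly d a q x) \<le> (\<Prod>j<d. B j)" for x
    proof -
      have "(1 + enorm d x) ^ N \<le> (\<Prod>j<d. 1 + \<bar>x j\<bar>) ^ N"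
        by (intro power_mono one_plus_enorm_le_prod) (simp add: enorm_def L2_set_nonneg)
      then have "(1 + enorm d x) ^ N * cmod (gauss_poly d a q x) \<le>
          (\<Prod>j<d. 1 + \<bar>x j\<bar>) ^ N * cmod (gauss_poly d a q x)"
        by (rule mult_right_mono) simp
      also have "\<dots> = (\<Prod>j<d. (1 + \<bar>x j\<bar>) ^ N * \<bar>poly (q j) (x j) * exp (- (x j - a j)\<^sup>2 / 2)\<bar>)"
        unfolding gauss_poly_def norm_of_real abs_prod prod_power_distrib prod.distrib[symmetric] ..
      also have "\<dots> \<le> (\<Prod>j<d. B j)"
        by (intro prod_mono) (use B in auto)
      finally show ?thesis .
    qed
    then show ?thesis by blast
  qed
  have diff: "(\<lambda>t. gauss_poly d a q (x(i := t))) differentiable (at (x i))" if "i < d" for q x i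
    using gauss_poly_has_partial[OF that] by (auto simp: has_vector_derivative_def differentiable_def)
  show ?thesis
    unfolding schwartz_def
  proof (intro CollectI allI impI)
    fix "is" :: "nat list"
    assume "set is \<subseteq> {..<d}"
    then obtain q where "foldr partial is (gauss_poly d a p) = gauss_poly d a q"
      using foldr_partial_gauss_poly by blast
    then show "(\<forall>x\<in>Rn d. \<forall>i<d. (\<lambda>t. foldr partial is (gauss_poly d a p) (x(i := t))) differentiable (at (x i))) \<and>
        (\<forall>N::nat. \<exists>B. \<forall>x\<in>Rn d. (1 + enorm d x) ^ N * cmod (foldr partial is (gauss_poly d a p) x) \<le> B)"
      using bound diff by simp
  qed
qed

definition gaussian :: "nat \<Rightarrow> (nat \<Rightarrow> real) \<Rightarrow> (nat \<Rightarrow> real) \<Rightarrow> real" where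
  "gaussian d a x = (\<Prod>j<d. exp (- (x j - a j)\<^sup>2 / 2))"

lemma gaussian_pos: "0 < gaussian d a x"
  by (simp add: gaussian_def prod_pos)

lemma gaussian_schwartz: "(\<lambda>x. complex_of_real (gaussian d a x)) \<in> schwartz d"
proof -
  have "(\<lambda>x. complex_of_real (gaussian d a x)) = gauss_poly d a (\<lambda>_. 1)"
    by (simp add: gaussian_def gauss_poly_def fun_eq_iff)
  then show ?thesis using gauss_poly_schwartz by simp
qed

lemma measurable_gaussian [measurable]: "gaussian d a \<in> borel_measurable (leb d)"
  unfolding gaussian_def
  by (intro borel_measurable_prod borel_measurable_exp borel_measurable_divide borel_measurable_uminus
      borel_measurable_power borel_measurable_diff borel_measurable_const measurable_component_leb) auto

text \<open>This is the characteristic function of the standard normal distribution, scaled by sqrt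
  (2 pi) to undo the normalisation of the density and translated by \<open>a\<close>, which produces
  the last exponential.\<close>

lemma gaussian_fourier_1:
  fixes a s :: real
  shows "integrable lborel (\<lambda>x. complex_of_real (exp (- (x - a)\<^sup>2 / 2)) * exp (\<i> * complex_of_real (s * x)))"
    and "(LINT x|lborel. complex_of_real (exp (- (x - a)\<^sup>2 / 2)) * exp (\<i> * complex_of_real (s * x))) =
      complex_of_real (sqrt (2 * pi) * exp (- s\<^sup>2 / 2)) * exp (\<i> * complex_of_real (s * a))"
proof -
  define k where "k x = complex_of_real (exp (- x\<^sup>2 / 2)) * exp (\<i> * complex_of_real (s * x))" for x
  have eq: "complex_of_real (exp (- x\<^sup>2 / 2)) = complex_of_real (sqrt (2 * pi)) * complex_of_real (std_normal_density x)" for x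
    by (simp add: std_normal_density_def)
  have ik: "integrable lborel k"
  proof (rule Bochner_Integration.integrable_bound)
    show "integrable lborel (\<lambda>x. sqrt (2 * pi) * std_normal_density x)" by simp
    show "k \<in> borel_measurable lborel" unfolding k_def by simp
  qed (auto simp: k_def norm_mult std_normal_density_def)
  have "complex_of_real (exp (- s\<^sup>2 / 2)) = (LINT x|std_normal_distribution. exp (\<i> * complex_of_real (s * x)))"
    using char_std_normal_distribution by (simp add: char_def fun_eq_iff)
  also have "\<dots> = (LINT x|lborel. std_normal_density x *\<^sub>R exp (\<i> * complex_of_real (s * x)))"
    by (subst integral_density) auto
  finally have *: "(LINT x|lborel. std_normal_density x *\<^sub>R exp (\<i> * complex_of_real (s * x))) =
      complex_of_real (exp (- s\<^sup>2 / 2))" ..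
  have "k = (\<lambda>x. complex_of_real (sqrt (2 * pi)) * (std_normal_density x *\<^sub>R exp (\<i> * complex_of_real (s * x))))"
    by (rule ext) (simp only: k_def eq scaleR_conv_of_real mult.assoc)
  then have "(LINT x|lborel. k x) = complex_of_real (sqrt (2 * pi)) *
      (LINT x|lborel. std_normal_density x *\<^sub>R exp (\<i> * complex_of_real (s * x)))"
    by (simp only: integral_mult_right_zero)
  then have "(LINT x|lborel. k x) = complex_of_real (sqrt (2 * pi) * exp (- s\<^sup>2 / 2))"
    unfolding * by simp
  moreover have shift: "complex_of_real (exp (- (x - a)\<^sup>2 / 2)) * exp (\<i> * complex_of_real (s * x)) =
      k (- a + 1 * x) * exp (\<i> * complex_of_real (s * a))" for x
    by (simp add: k_def mult.assoc algebra_simps flip: exp_add)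
  ultimately show "(LINT x|lborel. complex_of_real (exp (- (x - a)\<^sup>2 / 2)) * exp (\<i> * complex_of_real (s * x))) =
      complex_of_real (sqrt (2 * pi) * exp (- s\<^sup>2 / 2)) * exp (\<i> * complex_of_real (s * a))"
    unfolding shift using lborel_integral_real_affine[of 1 k "- a"] by simp
  show "integrable lborel (\<lambda>x. complex_of_real (exp (- (x - a)\<^sup>2 / 2)) * exp (\<i> * complex_of_real (s * x)))"
    unfolding shift using lborel_integrable_real_affine[OF ik, of 1 "- a"] by simp
qed

lemma gaussian_fourier:
  shows "integrable (leb d) (\<lambda>x. complex_of_real (gaussian d a x) * exp (\<i> * complex_of_real (ip d b x)))" (is ?I)
    and "(LINT x|leb d. complex_of_real (gaussian d a x) * exp (\<i> * complex_of_real (ip d b x))) =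
      complex_of_real (sqrt (2 * pi) ^ d * gaussian d (\<lambda>_. 0) b) * exp (\<i> * complex_of_real (ip d b a))" (is ?E)
proof -
  define k where "k j t = complex_of_real (exp (- (t - a j)\<^sup>2 / 2)) * exp (\<i> * complex_of_real (b j * t))" for j t
  have k: "complex_of_real (gaussian d a x) * exp (\<i> * complex_of_real (ip d b x)) = (\<Prod>j<d. k j (x j))" for x
    by (simp add: k_def gaussian_def ip_def prod.distrib sum_distrib_left exp_sum)
  have ik: "integrable lborel (k j)" for j unfolding k_def by (rule gaussian_fourier_1)
  have ip: "integrable (\<Pi>\<^sub>M j\<in>{..<d}. lborel) (\<lambda>x. \<Prod>j<d. k j (x j))"
    by (rule product_sigma_finite_lborel.product_integrable_prod) (use ik in auto)
  show ?I unfolding k leb_def using ip by (subst integrable_completion) auto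
  have "(LINT x|leb d. (\<Prod>j<d. k j (x j))) = (\<Prod>j<d. LINT t|lborel. k j t)"
    unfolding leb_def using ip
    by (subst integral_completion)
      (auto intro!: product_sigma_finite_lborel.product_integral_prod ik)
  also have "\<dots> = complex_of_real (sqrt (2 * pi) ^ d * gaussian d (\<lambda>_. 0) b) * exp (\<i> * complex_of_real (ip d b a))"
    unfolding k_def gaussian_fourier_1
    by (simp add: gaussian_def ip_def prod.distrib sum_distrib_left exp_sum)
  finally show ?E unfolding k .
qed

lemma fourier_integral_gaussian:
  "fourier_integral d (\<lambda>x. complex_of_real (gaussian d a x)) \<omega> =
    complex_of_real (sqrt (2 * pi) ^ d / (2 * pi) ^ d * gaussian d (\<lambda>_. 0) \<omega>) *
      exp (- \<i> * complex_of_real (ip d \<omega> a))"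
proof -
  have neg: "- \<i> * complex_of_real (ip d \<omega> x) = \<i> * complex_of_real (ip d (\<lambda>j. - \<omega> j) x)" for x
    by (simp add: ip_def sum_negf)
  have "gaussian d (\<lambda>_. 0) (\<lambda>j. - \<omega> j) = gaussian d (\<lambda>_. 0) \<omega>"
    by (simp add: gaussian_def)
  then show ?thesis
    unfolding fourier_integral_def neg gaussian_fourier by simp
qed

text \<open>As \<open>f\<close> need not be integrable, it is compared with the inverse transform
  \<open>F\<close> of \<open>g\<close> after damping both by the Gaussian \<gamma> centred at 0. The
  transform of a Gaussian centred at - b is \<gamma> modulated by the frequency b, up to a constant.
  Testing the definition with it therefore evaluates the Fourier integral of \<gamma> f at b, and
  Fubini gives the same value for \<gamma> F. So \<gamma> (f - F) has vanishing transform, hence is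
  0 almost everywhere, and \<gamma> is positive.\<close>

lemma has_fourier_transform_inversion:
  assumes fg: "has_fourier_transform d f g" and g: "integrable (leb d) g"
  shows "AE x in leb d. f x = (LINT \<omega>|leb d. g \<omega> * exp (\<i> * complex_of_real (ip d \<omega> x)))"
proof -
  interpret leb: sigma_finite_measure "leb d" by (rule sigma_finite_leb)
  interpret P: pair_sigma_finite "leb d" "leb d" ..
  note [measurable] = borel_measurable_integrable[OF g]
  define F where "F x = (LINT \<omega>|leb d. g \<omega> * exp (\<i> * complex_of_real (ip d \<omega> x)))" for x
  define \<gamma> where "\<gamma> x = complex_of_real (gaussian d (\<lambda>_. 0) x)" for x
  define K where "K b x \<omega> = \<gamma> x * exp (\<i> * complex_of_real (ip d b x)) *
    (g \<omega> * exp (\<i> * complex_of_real (ip d \<omega> x)))" for b x \<omega>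
  have [measurable]: "f \<in> borel_measurable (leb d)"
    using fg by (simp add: has_fourier_transform_def tempered_def)
  have [measurable]: "\<gamma> \<in> borel_measurable (leb d)" unfolding \<gamma>_def by measurable
  have [measurable]: "(\<lambda>x. ip d b x) \<in> borel_measurable (leb d)" for b
    unfolding ip_def by (intro borel_measurable_sum borel_measurable_times borel_measurable_const measurable_component_leb) auto
  have Kmeas: "(\<lambda>(x, \<omega>). K b x \<omega>) \<in> borel_measurable (leb d \<Otimes>\<^sub>M leb d)" for b
    unfolding K_def by measurable
  have int_f: "integrable (leb d) (\<lambda>x. f x * complex_of_real (gaussian d a x))" for a
    using fg gaussian_schwartz by (auto simp: has_fourier_transform_def tempered_def)
  have int_\<gamma>: "integrable (leb d) \<gamma>"
    using gaussian_fourier(1)[of d "\<lambda>_. 0" "\<lambda>_. 0"] by (simp add: \<gamma>_def[abs_def] ip_def)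
  have int_K: "integrable (leb d \<Otimes>\<^sub>M leb d) (\<lambda>(x, \<omega>). K b x \<omega>)" for b
  proof (rule P.Fubini_integrable[OF Kmeas])
    have "integrable (leb d) (\<lambda>x. norm (\<gamma> x) * (LINT \<omega>|leb d. norm (g \<omega>)))"
      using int_\<gamma> by auto
    then show "integrable (leb d) (\<lambda>x. LINT \<omega>|leb d. norm (case (x, \<omega>) of (x, \<omega>) \<Rightarrow> K b x \<omega>))"
      by (simp add: K_def norm_mult)
    show "AE x in leb d. integrable (leb d) (\<lambda>\<omega>. case (x, \<omega>) of (x, \<omega>) \<Rightarrow> K b x \<omega>)"
    proof (rule AE_I2, rule Bochner_Integration.integrable_bound)
      fix x assume x: "x \<in> space (leb d)"
      show "integrable (leb d) (\<lambda>\<omega>. norm (\<gamma> x) * norm (g \<omega>))" using g by auto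
      show "(\<lambda>\<omega>. case (x, \<omega>) of (x, \<omega>) \<Rightarrow> K b x \<omega>) \<in> borel_measurable (leb d)"
        using measurable_Pair2[OF Kmeas x] by simp
    qed (simp add: K_def norm_mult)
  qed
  have int_F: "integrable (leb d) (\<lambda>x. \<gamma> x * exp (\<i> * complex_of_real (ip d b x)) * F x)" for b
    using P.integrable_fst[OF int_K[of b]] by (simp add: K_def F_def)
  have F_int: "(LINT x|leb d. \<gamma> x * exp (\<i> * complex_of_real (ip d b x)) * F x) =
      complex_of_real (sqrt (2 * pi) ^ d) * (LINT \<omega>|leb d. g \<omega> * complex_of_real (gaussian d (\<lambda>j. - b j) \<omega>))" for b
  proof -
    have "(LINT x|leb d. \<gamma> x * exp (\<i> * complex_of_real (ip d b x)) * F x) = (LINT x|leb d. (LINT \<omega>|leb d. K b x \<omega>))"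
      by (simp add: K_def F_def)
    also have "\<dots> = (LINT \<omega>|leb d. (LINT x|leb d. K b x \<omega>))"
      by (rule P.Fubini_integral[symmetric]) (rule int_K)
    also have "\<dots> = (LINT \<omega>|leb d. complex_of_real (sqrt (2 * pi) ^ d) * (g \<omega> * complex_of_real (gaussian d (\<lambda>j. - b j) \<omega>)))"
    proof (intro Bochner_Integration.integral_cong refl)
      fix \<omega>
      \<comment> \<open>The two exponentials merge into one of frequency \<omega> + b. The inner
        integral is then a Gaussian in \<omega> + b, that is, one in \<omega> centred at -
        b.\<close>
      have "K b x \<omega> = g \<omega> * (\<gamma> x * exp (\<i> * complex_of_real (ip d (\<lambda>j. \<omega> j + b j) x)))" for x
        by (simp add: K_def ip_def distrib_left distrib_right sum.distrib exp_add mult_ac)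
      then have "(LINT x|leb d. K b x \<omega>) =
          g \<omega> * (LINT x|leb d. \<gamma> x * exp (\<i> * complex_of_real (ip d (\<lambda>j. \<omega> j + b j) x)))"
        by simp
      also have "(LINT x|leb d. \<gamma> x * exp (\<i> * complex_of_real (ip d (\<lambda>j. \<omega> j + b j) x))) =
          complex_of_real (sqrt (2 * pi) ^ d * gaussian d (\<lambda>_. 0) (\<lambda>j. \<omega> j + b j))"
        unfolding \<gamma>_def gaussian_fourier by (simp add: ip_def)
      also have "gaussian d (\<lambda>_. 0) (\<lambda>j. \<omega> j + b j) = gaussian d (\<lambda>j. - b j) \<omega>"
        by (simp add: gaussian_def)
      finally show "(LINT x|leb d. K b x \<omega>) =
          complex_of_real (sqrt (2 * pi) ^ d) * (g \<omega> * complex_of_real (gaussian d (\<lambda>j. - b j) \<omega>))"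
        by simp
    qed
    finally show ?thesis by simp
  qed
  have f_int: "(LINT x|leb d. \<gamma> x * exp (\<i> * complex_of_real (ip d b x)) * f x) =
      complex_of_real (sqrt (2 * pi) ^ d) * (LINT \<omega>|leb d. g \<omega> * complex_of_real (gaussian d (\<lambda>j. - b j) \<omega>))" for b
  proof -
    have "(LINT \<omega>|leb d. g \<omega> * complex_of_real (gaussian d (\<lambda>j. - b j) \<omega>)) =
      (LINT x|leb d. f x * fourier_integral d (\<lambda>x. complex_of_real (gaussian d (\<lambda>j. - b j) x)) x)"
      using fg gaussian_schwartz by (auto simp: has_fourier_transform_def)
    also have "\<dots> = (LINT x|leb d. complex_of_real (sqrt (2 * pi) ^ d / (2 * pi) ^ d) *
        (\<gamma> x * exp (\<i> * complex_of_real (ip d b x)) * f x))"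
      unfolding fourier_integral_gaussian \<gamma>_def
      by (intro Bochner_Integration.integral_cong refl)
        (simp add: ip_def sum_negf mult_ac)
    also have "\<dots> = complex_of_real (sqrt (2 * pi) ^ d / (2 * pi) ^ d) *
        (LINT x|leb d. \<gamma> x * exp (\<i> * complex_of_real (ip d b x)) * f x)"
      by (rule integral_mult_right_zero)
    finally have "complex_of_real (sqrt (2 * pi) ^ d) * (LINT \<omega>|leb d. g \<omega> * complex_of_real (gaussian d (\<lambda>j. - b j) \<omega>)) =
      complex_of_real (sqrt (2 * pi) ^ d * (sqrt (2 * pi) ^ d / (2 * pi) ^ d)) *
        (LINT x|leb d. \<gamma> x * exp (\<i> * complex_of_real (ip d b x)) * f x)"
      by (simp only: of_real_mult mult.assoc)
    \<comment> \<open>The prefactor of \<open>fourier_integral\<close> is cancelled exactly by two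
      Gaussian factors sqrt (2 pi)^d.\<close>
    also have "sqrt (2 * pi) ^ d * (sqrt (2 * pi) ^ d / (2 * pi) ^ d) = 1"
    proof -
      have "sqrt (2 * pi) ^ d * sqrt (2 * pi) ^ d = (2 * pi) ^ d"
        unfolding power_mult_distrib[symmetric] by simp
      then show ?thesis by simp
    qed
    finally show ?thesis by simp
  qed
  have int_f': "integrable (leb d) (\<lambda>x. \<gamma> x * exp (\<i> * complex_of_real (ip d b x)) * f x)" for b
    by (rule Bochner_Integration.integrable_bound[OF int_f[of "\<lambda>_. 0"]]) (auto simp: norm_mult \<gamma>_def)
  have "AE x in leb d. \<gamma> x * (f x - F x) = 0"
  proof (rule fourier_uniqueness_leb)
    show "integrable (leb d) (\<lambda>x. \<gamma> x * (f x - F x))"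
      using Bochner_Integration.integrable_diff[OF int_f'[of "\<lambda>_. 0"] int_F[of "\<lambda>_. 0"]]
      by (simp add: ip_def right_diff_distrib)
    fix b
    have "(LINT x|leb d. \<gamma> x * (f x - F x) * exp (\<i> * complex_of_real (ip d b x))) =
      (LINT x|leb d. \<gamma> x * exp (\<i> * complex_of_real (ip d b x)) * f x - \<gamma> x * exp (\<i> * complex_of_real (ip d b x)) * F x)"
      by (simp add: algebra_simps)
    also have "\<dots> = 0"
      by (subst Bochner_Integration.integral_diff[OF int_f' int_F]) (simp add: f_int F_int)
    finally show "(LINT x|leb d. \<gamma> x * (f x - F x) * exp (\<i> * complex_of_real (ip d b x))) = 0" .
  qed
  then show ?thesis
    by eventually_elim (use gaussian_pos[of d "\<lambda>_. 0"] in \<open>auto simp: \<gamma>_def F_def less_le\<close>)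
qed

section \<open>Monte Carlo approximation\<close>

text \<open>
  The sample points are chosen one after another: given the first \<open>n\<close> of them, the expectation
  over the next one of the squared error exceeds the current value by at most the variance, so
  some point does no worse.  This needs no product measure for independent samples.
\<close>

lemma monte_carlo:
  fixes Y :: "'a \<Rightarrow> 'b \<Rightarrow> real"
  assumes P: "prob_space P" and M: "finite_measure M"
    and meas: "(\<lambda>(t, x). Y t x) \<in> borel_measurable (P \<Otimes>\<^sub>M M)"
    and bound: "\<And>t x. t \<in> space P \<Longrightarrow> x \<in> space M \<Longrightarrow> \<bar>Y t x\<bar> \<le> Z"
  shows "\<exists>\<theta>. (\<forall>i. \<theta> i \<in> space P) \<and>
    (\<integral>\<^sup>+x. ennreal ((\<Sum>i<n. Y (\<theta> i) x - (LINT t|P. Y t x))\<^sup>2) \<partial>M) \<le> ennreal (real n * (Z\<^sup>2 * measure M (space M)))"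
proof -
  interpret P: prob_space P by fact
  interpret M: finite_measure M by fact
  interpret PM: pair_sigma_finite P M ..
  interpret PM': finite_measure "P \<Otimes>\<^sub>M M" by (rule finite_measure_pair_measure) unfold_locales
  define F where "F x = (LINT t|P. Y t x)" for x
  have [measurable]: "(\<lambda>x. Y t x) \<in> borel_measurable M" if "t \<in> space P" for t
    using measurable_Pair2[OF meas that] by simp
  have [measurable]: "(\<lambda>t. Y t x) \<in> borel_measurable P" if "x \<in> space M" for x
    using measurable_Pair1[OF meas that] by simp
  have "(\<lambda>(x, t). Y t x) \<in> borel_measurable (M \<Otimes>\<^sub>M P)"
    using measurable_compose[OF measurable_pair_swap' meas] by (simp add: case_prod_beta)
  then have [measurable]: "F \<in> borel_measurable M"
    unfolding F_def by (rule P.borel_measurable_lebesgue_integral)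
  have iY: "integrable P (\<lambda>t. Y t x)" if "x \<in> space M" for x
    using that bound by (intro P.integrable_const_bound[of _ Z]) auto
  have iY2: "integrable P (\<lambda>t. (Y t x)\<^sup>2)" if "x \<in> space M" for x
  proof (rule P.integrable_const_bound[of _ "Z\<^sup>2"])
    show "AE t in P. norm ((Y t x)\<^sup>2) \<le> Z\<^sup>2"
      using bound that by (intro AE_I2) (auto intro!: abs_le_square_iff[THEN iffD1] intro: order_trans[OF _ abs_ge_self])
  qed (use that in measurable)
  have F_bound: "\<bar>F x\<bar> \<le> Z" if "x \<in> space M" for x
  proof -
    have "\<bar>F x\<bar> \<le> (LINT t|P. \<bar>Y t x\<bar>)" unfolding F_def by (rule integral_abs_bound)
    also have "\<dots> \<le> (LINT t|P. Z)"
      using iY[OF that] bound that by (intro integral_mono) auto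
    finally show ?thesis by (simp add: P.prob_space)
  qed
  have sum_meas: "(\<lambda>x. \<Sum>i<n. Y (\<theta> i) x - F x) \<in> borel_measurable M" if "\<forall>i. \<theta> i \<in> space P" for \<theta> and n :: nat
    using that by (intro borel_measurable_sum borel_measurable_diff) auto
  have sum_bound: "\<bar>\<Sum>i<n. Y (\<theta> i) x - F x\<bar> \<le> real n * (2 * Z)" if "\<forall>i. \<theta> i \<in> space P" "x \<in> space M" for \<theta> x and n :: nat
  proof -
    have "\<bar>Y (\<theta> i) x - F x\<bar> \<le> 2 * Z" for i
      using bound[of "\<theta> i" x] F_bound[of x] that by auto
    then have "(\<Sum>i<n. \<bar>Y (\<theta> i) x - F x\<bar>) \<le> (\<Sum>i<n. 2 * Z)"
      by (intro sum_mono) auto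
    then show ?thesis by (intro order_trans[OF sum_abs]) simp
  qed
  have iS: "integrable M (\<lambda>x. (\<Sum>i<n. Y (\<theta> i) x - F x)\<^sup>2)" if "\<forall>i. \<theta> i \<in> space P" for \<theta> and n :: nat
  proof (rule M.integrable_const_bound[of _ "(real n * (2 * Z))\<^sup>2"])
    show "AE x in M. norm ((\<Sum>i<n. Y (\<theta> i) x - F x)\<^sup>2) \<le> (real n * (2 * Z))\<^sup>2"
      using sum_bound[OF that, of _ n]
      by (intro AE_I2) (auto intro!: abs_le_square_iff[THEN iffD1] intro: order_trans[OF _ abs_ge_self])
  qed (use sum_meas[OF that, of n] in measurable)
  have "\<exists>\<theta>. (\<forall>i. \<theta> i \<in> space P) \<and>
    (LINT x|M. (\<Sum>i<n. Y (\<theta> i) x - F x)\<^sup>2) \<le> real n * (Z\<^sup>2 * measure M (space M))"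
  proof (induction n)
    case 0
    obtain t where "t \<in> space P" using P.not_empty by auto
    then show ?case by (intro exI[of _ "\<lambda>_. t"]) simp
  next
    case (Suc n)
    then obtain \<theta> where \<theta>: "\<forall>i. \<theta> i \<in> space P"
      and le: "(LINT x|M. (\<Sum>i<n. Y (\<theta> i) x - F x)\<^sup>2) \<le> real n * (Z\<^sup>2 * measure M (space M))" by blast
    define S where "S x = (\<Sum>i<n. Y (\<theta> i) x - F x)" for x
    have [measurable]: "S \<in> borel_measurable M" unfolding S_def by (rule sum_meas[OF \<theta>])
    define U where "U t x = (S x + (Y t x - F x))\<^sup>2" for t x
    have U_meas: "(\<lambda>(t, x). U t x) \<in> borel_measurable (P \<Otimes>\<^sub>M M)"
    proof -
      note meas[measurable]
      show ?thesis unfolding U_def by measurable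
    qed
    have iU: "integrable (P \<Otimes>\<^sub>M M) (\<lambda>(t, x). U t x)"
    proof (rule PM'.integrable_const_bound[of _ "(real n * (2 * Z) + 2 * Z)\<^sup>2"])
      have "\<bar>S x + (Y t x - F x)\<bar> \<le> real n * (2 * Z) + 2 * Z" if "t \<in> space P" "x \<in> space M" for t x
        using sum_bound[OF \<theta> that(2), of n] bound[OF that] F_bound[OF that(2)] by (auto simp: S_def)
      then show "AE z in P \<Otimes>\<^sub>M M. norm (case z of (t, x) \<Rightarrow> U t x) \<le> (real n * (2 * Z) + 2 * Z)\<^sup>2"
        by (intro AE_I2) (force simp: U_def space_pair_measure intro!: abs_le_square_iff[THEN iffD1] intro: order_trans[OF _ abs_ge_self])
    qed (rule U_meas)
    \<comment> \<open>The new term Y - F has mean 0, so its correlation with \<open>S\<close>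
      disappears and only its variance, at most Z^2, is added.\<close>
    have mean: "(LINT t|P. U t x) \<le> (S x)\<^sup>2 + Z\<^sup>2" if x: "x \<in> space M" for x
    proof -
      have "(LINT t|P. U t x) = (LINT t|P. (S x - F x)\<^sup>2 + 2 * (S x - F x) * Y t x + (Y t x)\<^sup>2)"
        by (simp add: U_def power2_eq_square algebra_simps)
      also have "\<dots> = (S x - F x)\<^sup>2 + 2 * (S x - F x) * F x + (LINT t|P. (Y t x)\<^sup>2)"
        using iY[OF x] iY2[OF x] by (simp add: F_def P.prob_space)
      also have "\<dots> = (S x)\<^sup>2 - (F x)\<^sup>2 + (LINT t|P. (Y t x)\<^sup>2)"
        by (simp add: power2_eq_square algebra_simps)
      also have "(LINT t|P. (Y t x)\<^sup>2) \<le> (LINT t|P. Z\<^sup>2)"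
        using iY2[OF x] bound x
        by (intro integral_mono) (auto intro!: abs_le_square_iff[THEN iffD1] intro: order_trans[OF _ abs_ge_self])
      finally show ?thesis by (simp add: P.prob_space) (use zero_le_power2[of "F x"] in linarith)
    qed
    have iUt: "integrable P (\<lambda>t. LINT x|M. U t x)" using PM.integrable_fst[OF iU] .
    have "(LINT t|P. (LINT x|M. U t x)) = (LINT x|M. (LINT t|P. U t x))"
      by (rule PM.Fubini_integral[OF iU, symmetric])
    also have "\<dots> \<le> (LINT x|M. (S x)\<^sup>2 + Z\<^sup>2)"
      using PM.integrable_snd[OF iU] iS[OF \<theta>, of n] mean by (intro integral_mono) (auto simp: S_def)
    also have "\<dots> = (LINT x|M. (S x)\<^sup>2) + Z\<^sup>2 * measure M (space M)"
      using iS[OF \<theta>, of n] by (subst Bochner_Integration.integral_add) (auto simp: S_def)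
    also have "\<dots> \<le> real (Suc n) * (Z\<^sup>2 * measure M (space M))"
      using le by (simp add: S_def algebra_simps)
    finally have total: "(LINT t|P. (LINT x|M. U t x)) \<le> real (Suc n) * (Z\<^sup>2 * measure M (space M))" .
    \<comment> \<open>Not every \<open>t\<close> can give a value strictly above the
      average.\<close>
    have "\<exists>t\<in>space P. (LINT x|M. U t x) \<le> (LINT t|P. (LINT x|M. U t x))"
    proof (rule ccontr)
      assume "\<not> ?thesis"
      then have "(LINT t|P. (LINT t|P. (LINT x|M. U t x))) < (LINT t|P. (LINT x|M. U t x))"
        using iUt by (intro P.integral_less_AE_space) (auto simp: P.emeasure_space_1 not_le)
      then show False by (simp add: P.prob_space)
    qed
    then obtain t where t: "t \<in> space P" "(LINT x|M. U t x) \<le> real (Suc n) * (Z\<^sup>2 * measure M (space M))"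
      using total by force
    have "(\<Sum>i<Suc n. Y ((\<theta>(n := t)) i) x - F x) = S x + (Y t x - F x)" for x
      by (simp add: S_def)
    then have "(LINT x|M. (\<Sum>i<Suc n. Y ((\<theta>(n := t)) i) x - F x)\<^sup>2) \<le> real (Suc n) * (Z\<^sup>2 * measure M (space M))"
      using t(2) by (simp only: U_def)
    then show ?case using \<theta> t(1) by (intro exI[of _ "\<theta>(n := t)"]) auto
  qed
  then obtain \<theta> where \<theta>: "\<forall>i. \<theta> i \<in> space P"
    and le: "(LINT x|M. (\<Sum>i<n. Y (\<theta> i) x - F x)\<^sup>2) \<le> real n * (Z\<^sup>2 * measure M (space M))" by blast
  then show ?thesis
    unfolding F_def[symmetric] using iS[OF \<theta>, of n]
    by (intro exI[of _ \<theta>]) (auto simp: nn_integral_eq_integral)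
qed

text \<open>Importance sampling: points are drawn with density q / Z, where Z is the integral of
  \<open>q\<close>, and the kernel is reweighted to Z K / q. The mean is still the wanted integral,
  while the domination of \<open>K\<close> by \<open>q\<close> bounds every sample by the constant
  Z. A kernel on a possibly infinite measure space thus becomes a bounded one on a probability
  space.\<close>

lemma weighted_monte_carlo:
  fixes K :: "'a \<Rightarrow> 'b \<Rightarrow> real"
  assumes N: "sigma_finite_measure N" "space N \<noteq> {}" and M: "finite_measure M"
    and meas: "(\<lambda>(t, x). K t x) \<in> borel_measurable (N \<Otimes>\<^sub>M M)"
    and q: "integrable N q"
    and bound: "\<And>t x. t \<in> space N \<Longrightarrow> x \<in> space M \<Longrightarrow> \<bar>K t x\<bar> \<le> q t"
    and q_nonneg: "\<And>t. 0 \<le> q t" and n: "n > 0"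
  shows "\<exists>\<theta> \<beta>. (\<forall>i. \<theta> i \<in> space N) \<and>
    (\<integral>\<^sup>+x. ennreal (((LINT t|N. K t x) - (\<Sum>i<n. \<beta> i * K (\<theta> i) x))\<^sup>2) \<partial>M) \<le>
      ennreal ((LINT t|N. q t)\<^sup>2 * measure M (space M) / real n)"
proof -
  interpret N: sigma_finite_measure N by fact
  interpret M: finite_measure M by fact
  note [measurable] = borel_measurable_integrable[OF q]
  have [measurable]: "(\<lambda>t. K t x) \<in> borel_measurable N" if "x \<in> space M" for x
    using measurable_Pair1[OF meas that] by simp
  define Z where "Z = (LINT t|N. q t)"
  have "Z \<ge> 0" unfolding Z_def using q_nonneg by simp
  show ?thesis
  proof (cases "Z = 0")
    \<comment> \<open>Without mass there is no density to normalise. Here \<open>K t x\<close>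
      vanishes for almost all \<open>t\<close>, so zero coefficients give no error.\<close>
    case True
    then have q0: "AE t in N. q t = 0"
      using integral_nonneg_eq_0_iff_AE[OF q] q_nonneg by (auto simp: Z_def)
    have "(LINT t|N. K t x) = 0" if x: "x \<in> space M" for x
    proof -
      have "AE t in N. K t x = 0"
        using q0 AE_space by eventually_elim (use bound x in force)
      then have "(LINT t|N. K t x) = (LINT t|N. 0)"
        by (rule integral_cong_AE[rotated 2]) (use x in measurable)
      then show ?thesis by simp
    qed
    then have "(\<integral>\<^sup>+x. ennreal (((LINT t|N. K t x) - (\<Sum>i<n. 0 * K (\<theta> i) x))\<^sup>2) \<partial>M) = 0" for \<theta>
      by (simp cong: nn_integral_cong)
    moreover obtain t where "t \<in> space N" using N(2) by auto
    ultimately show ?thesis by (intro exI[of _ "\<lambda>_. t"] exI[of _ "\<lambda>_. 0"]) simp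
  next
    case False
    then have Z: "Z > 0" using \<open>Z \<ge> 0\<close> by simp
    define P where "P = density N (\<lambda>t. ennreal (q t / Z))"
    have sP: "space P = space N" by (simp add: P_def)
    have setsP: "sets P = sets N" by (simp add: P_def)
    have "emeasure P (space P) = (\<integral>\<^sup>+t. ennreal (q t / Z) \<partial>N)"
      by (simp add: P_def emeasure_density cong: nn_integral_cong_simp)
    also have "\<dots> = ennreal (LINT t|N. q t / Z)"
      using q q_nonneg Z by (intro nn_integral_eq_integral) auto
    also have "\<dots> = 1" using Z by (simp add: Z_def)
    finally have P: "prob_space P" by (rule prob_spaceI)
    \<comment> \<open>Where \<open>q t = 0\<close>, \<open>K t x\<close> vanishes too, so the value \<open>0\<close> of the quotient is the right one.\<close>
    define Y where "Y t x = Z * K t x / q t" for t x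
    have "(\<lambda>(t, x). Y t x) \<in> borel_measurable (N \<Otimes>\<^sub>M M)"
    proof -
      note meas[measurable]
      show ?thesis unfolding Y_def by measurable
    qed
    then have Y_meas: "(\<lambda>(t, x). Y t x) \<in> borel_measurable (P \<Otimes>\<^sub>M M)"
      using setsP by (simp cong: measurable_cong_sets sets_pair_measure_cong)
    have Y_bound: "\<bar>Y t x\<bar> \<le> Z" if "t \<in> space P" "x \<in> space M" for t x
    proof (cases "q t = 0")
      case True
      then show ?thesis using Z by (simp add: Y_def)
    next
      case False
      then have "q t > 0" using q_nonneg[of t] by simp
      then show ?thesis using bound[of t x] that Z by (simp add: Y_def abs_mult sP field_simps)
    qed
    have Y_int: "(LINT t|P. Y t x) = (LINT t|N. K t x)" if x: "x \<in> space M" for x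
    proof -
      have [measurable]: "(\<lambda>t. Y t x) \<in> borel_measurable N" unfolding Y_def using x by measurable
      have "(LINT t|P. Y t x) = (LINT t|N. (q t / Z) *\<^sub>R Y t x)"
        unfolding P_def using q_nonneg Z by (subst integral_density) auto
      also have "\<dots> = (LINT t|N. K t x)"
        using Z bound x by (intro Bochner_Integration.integral_cong) (force simp: Y_def)+
      finally show ?thesis .
    qed
    obtain \<theta> where \<theta>: "\<forall>i. \<theta> i \<in> space P"
      and le: "(\<integral>\<^sup>+x. ennreal ((\<Sum>i<n. Y (\<theta> i) x - (LINT t|P. Y t x))\<^sup>2) \<partial>M) \<le>
        ennreal (real n * (Z\<^sup>2 * measure M (space M)))"
      using monte_carlo[OF P M Y_meas Y_bound] by blast
    \<comment> \<open>The average 1 / n times the importance weight Z / q at the sample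
      point.\<close>
    define \<beta> where "\<beta> i = Z / (real n * q (\<theta> i))" for i
    have Ym: "(\<lambda>x. Y (\<theta> i) x) \<in> borel_measurable M" for i
      using measurable_Pair2[OF Y_meas, of "\<theta> i"] \<theta> by simp
    have "(\<integral>\<^sup>+x. ennreal (((LINT t|N. K t x) - (\<Sum>i<n. \<beta> i * K (\<theta> i) x))\<^sup>2) \<partial>M) =
      (\<integral>\<^sup>+x. ennreal (1 / (real n)\<^sup>2) * ennreal ((\<Sum>i<n. Y (\<theta> i) x - (LINT t|P. Y t x))\<^sup>2) \<partial>M)"
    proof (intro nn_integral_cong)
      fix x assume x: "x \<in> space M"
      have "(\<Sum>i<n. Y (\<theta> i) x - (LINT t|P. Y t x)) = (\<Sum>i<n. Y (\<theta> i) x) - real n * (LINT t|N. K t x)"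
        using Y_int[OF x] by (simp add: sum_subtractf)
      also have "(\<Sum>i<n. Y (\<theta> i) x) = real n * (\<Sum>i<n. \<beta> i * K (\<theta> i) x)"
        using n by (auto simp: sum_distrib_left Y_def \<beta>_def intro!: sum.cong)
      finally have "(\<Sum>i<n. Y (\<theta> i) x - (LINT t|P. Y t x)) =
          - real n * ((LINT t|N. K t x) - (\<Sum>i<n. \<beta> i * K (\<theta> i) x))"
        by (simp add: algebra_simps)
      then show "ennreal (((LINT t|N. K t x) - (\<Sum>i<n. \<beta> i * K (\<theta> i) x))\<^sup>2) =
          ennreal (1 / (real n)\<^sup>2) * ennreal ((\<Sum>i<n. Y (\<theta> i) x - (LINT t|P. Y t x))\<^sup>2)"
        using n by (simp add: ennreal_mult[symmetric] power_mult_distrib)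
    qed
    also have "\<dots> = ennreal (1 / (real n)\<^sup>2) * (\<integral>\<^sup>+x. ennreal ((\<Sum>i<n. Y (\<theta> i) x - (LINT t|P. Y t x))\<^sup>2) \<partial>M)"
    proof (rule nn_integral_cmult)
      interpret P: prob_space P by fact
      have "(\<lambda>(x, t). Y t x) \<in> borel_measurable (M \<Otimes>\<^sub>M P)"
        using measurable_compose[OF measurable_pair_swap' Y_meas] by (simp add: case_prod_beta)
      then have [measurable]: "(\<lambda>x. LINT t|P. Y t x) \<in> borel_measurable M"
        by (rule P.borel_measurable_lebesgue_integral)
      note Ym[measurable]
      show "(\<lambda>x. ennreal ((\<Sum>i<n. Y (\<theta> i) x - (LINT t|P. Y t x))\<^sup>2)) \<in> borel_measurable M"
        by measurable
    qed
    also have "\<dots> \<le> ennreal (1 / (real n)\<^sup>2) * ennreal (real n * (Z\<^sup>2 * measure M (space M)))"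
      by (rule mult_left_mono[OF le]) simp
    also have "\<dots> = ennreal (Z\<^sup>2 * measure M (space M) / real n)"
      using n Z by (subst ennreal_mult[symmetric]) (auto simp: power2_eq_square field_simps)
    finally show ?thesis
      using \<theta> by (intro exI[of _ \<theta>] exI[of _ \<beta>]) (auto simp: sP Z_def)
  qed
qed

section \<open>Approximation by networks\<close>

text \<open>An open set is a union of boxes, but measurability needs a countable one. Taking the
  sides from a countable basis of the reals leaves only countably many boxes.\<close>

lemma openin_Rn_topology_sets:
  assumes "openin (Rn_topology d) \<Omega>"
  shows "\<Omega> \<in> sets (leb d)"
proof -
  obtain \<B> :: "real set set" where \<B>: "countable \<B>" "topological_basis \<B>"
    using ex_countable_basis by blast
  define C where "C = {Pi\<^sub>E {..<d} B |B. B \<in> ({..<d} \<rightarrow>\<^sub>E \<B>) \<and> Pi\<^sub>E {..<d} B \<subseteq> \<Omega>}"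
  have "countable ({..<d} \<rightarrow>\<^sub>E \<B>)" using \<B>(1) by (intro countable_PiE) auto
  then have "countable C"
    unfolding C_def by (rule countable_subset[rotated, OF countable_image[of _ "Pi\<^sub>E {..<d}"]]) auto
  moreover have "B \<in> sets (leb d)" if "B \<in> C" for B
  proof -
    obtain A where A: "B = Pi\<^sub>E {..<d} A" "A \<in> ({..<d} \<rightarrow>\<^sub>E \<B>)" using \<open>B \<in> C\<close> unfolding C_def by blast
    have "A i \<in> sets lborel" if "i < d" for i
      using A(2) that by (auto intro!: borel_open topological_basis_open[OF \<B>(2)])
    then show ?thesis
      unfolding A(1) leb_def by (intro sets_completionI_sets sets_PiM_I_finite) auto
  qed
  moreover have "\<Omega> = \<Union>C"
  proof
    show "\<Omega> \<subseteq> \<Union>C"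
    proof
      fix x assume "x \<in> \<Omega>"
      then obtain U where U: "\<forall>i<d. open (U i)" "x \<in> Pi\<^sub>E {..<d} U" "Pi\<^sub>E {..<d} U \<subseteq> \<Omega>"
      proof -
        have "\<forall>x\<in>\<Omega>. \<exists>U. finite {i \<in> {..<d}. U i \<noteq> topspace euclideanreal} \<and>
            (\<forall>i\<in>{..<d}. openin euclideanreal (U i)) \<and> x \<in> Pi\<^sub>E {..<d} U \<and> Pi\<^sub>E {..<d} U \<subseteq> \<Omega>"
          using assms unfolding Rn_topology_def openin_product_topology_alt by simp
        with \<open>x \<in> \<Omega>\<close> obtain U where "\<forall>i\<in>{..<d}. openin euclideanreal (U i)" "x \<in> Pi\<^sub>E {..<d} U" "Pi\<^sub>E {..<d} U \<subseteq> \<Omega>"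
          by blast
        then show ?thesis using that[of U] by simp
      qed
      have "\<forall>i. \<exists>B. i < d \<longrightarrow> B \<in> \<B> \<and> x i \<in> B \<and> B \<subseteq> U i"
      proof
        fix i
        show "\<exists>B. i < d \<longrightarrow> B \<in> \<B> \<and> x i \<in> B \<and> B \<subseteq> U i"
        proof (cases "i < d")
          case True
          then have "x i \<in> U i" "open (U i)" using U by auto
          then show ?thesis by (rule_tac topological_basisE[OF \<B>(2)]) auto
        qed auto
      qed
      then obtain B where B: "\<And>i. i < d \<Longrightarrow> B i \<in> \<B> \<and> x i \<in> B i \<and> B i \<subseteq> U i"
        by metis
      \<comment> \<open>Restriction puts the family into the countable set of extensional ones; the
        values of \<open>B\<close> from \<open>d\<close> on are arbitrary.\<close>
      let ?B = "restrict B {..<d}"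
      have eq: "Pi\<^sub>E {..<d} ?B = Pi\<^sub>E {..<d} B" by (rule PiE_cong) simp
      have "Pi\<^sub>E {..<d} B \<subseteq> \<Omega>"
        by (rule order_trans[OF PiE_mono U(3)]) (use B in simp)
      moreover have "?B \<in> {..<d} \<rightarrow>\<^sub>E \<B>" using B by (simp add: PiE_iff)
      ultimately have "Pi\<^sub>E {..<d} ?B \<in> C"
        unfolding C_def by (intro CollectI exI[of _ ?B] conjI) (simp_all only: eq)
      moreover have "x \<in> Pi\<^sub>E {..<d} ?B" using U(2) B by (auto simp: PiE_iff)
      ultimately show "x \<in> \<Union>C" by (rule UnionI)
    qed
  qed (auto simp: C_def)
  ultimately show ?thesis using sets.countable_Union[of C "leb d"] by auto
qed

lemma emeasure_leb_bounded:
  assumes "\<Omega> \<in> sets (leb d)" "\<And>x. x \<in> \<Omega> \<Longrightarrow> enorm d x \<le> B"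
  shows "emeasure (leb d) \<Omega> < \<infinity>"
proof -
  let ?Q = "Pi\<^sub>E {..<d} (\<lambda>_. {-B..B})"
  have Q: "?Q \<in> sets (\<Pi>\<^sub>M i\<in>{..<d}. lborel)" by (intro sets_PiM_I_finite) auto
  have "\<Omega> \<subseteq> ?Q"
  proof
    fix x assume x: "x \<in> \<Omega>"
    have "\<bar>x i\<bar> \<le> enorm d x" if "i < d" for i
      using member_le_L2_set[of "{..<d}" i "\<lambda>i. \<bar>x i\<bar>"] that by (simp add: enorm_def L2_set_def)
    then have "\<bar>x i\<bar> \<le> B" if "i < d" for i using assms(2)[OF x] that by force
    moreover have "x \<in> Rn d" using sets.sets_into_space[OF assms(1)] x by (auto simp: space_leb)
    ultimately show "x \<in> ?Q" by (force simp: Rn_def PiE_iff abs_le_iff)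
  qed
  then have "emeasure (leb d) \<Omega> \<le> emeasure (leb d) ?Q"
    using Q by (intro emeasure_mono) (auto simp: leb_def)
  also have "\<dots> = emeasure (\<Pi>\<^sub>M i\<in>{..<d}. lborel) ?Q" unfolding leb_def using Q by simp
  also have "\<dots> = (\<Prod>i<d. emeasure lborel {-B..B})"
    by (rule product_sigma_finite_lborel.emeasure_PiM) auto
  also have "\<dots> < \<infinity>" by (auto simp: emeasure_lborel_Icc_eq ennreal_prod_eq_top top.not_eq_extremum[symmetric] power_eq_top_ennreal)
  finally show ?thesis .
qed

text \<open>The norm bound makes the real supremum in \<open>diam\<close> meaningful, since all
  distances are then at most \<open>2 * B\<close>.\<close>

lemma edist_le_diam:
  assumes "\<And>x. x \<in> \<Omega> \<Longrightarrow> enorm d x \<le> B" "x \<in> \<Omega>" "y \<in> \<Omega>"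
  shows "edist d x y \<le> diam d \<Omega>"
proof -
  have "edist d u v \<le> 2 * B" if "u \<in> \<Omega>" "v \<in> \<Omega>" for u v
  proof -
    have "edist d u v = L2_set (\<lambda>i. u i + - v i) {..<d}" by (simp add: edist_def)
    also have "\<dots> \<le> enorm d u + enorm d (\<lambda>i. - v i)"
      unfolding enorm_def by (rule L2_set_triangle_ineq)
    also have "enorm d (\<lambda>i. - v i) = enorm d v" by (simp add: enorm_def L2_set_def)
    finally show ?thesis using assms(1)[OF that(1)] assms(1)[OF that(2)] by simp
  qed
  then have "bdd_above ((\<lambda>(x, y). edist d x y) ` (\<Omega> \<times> \<Omega>))"
    by (intro bdd_aboveI2[of _ _ "2 * B"]) auto
  then have "(case (x, y) of (x, y) \<Rightarrow> edist d x y) \<le> diam d \<Omega>"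
    unfolding diam_def using assms by (intro cSUP_upper) auto
  then show ?thesis by simp
qed

lemma ip_diff_bound: "\<bar>ip d w x - ip d w y\<bar> \<le> enorm d w * edist d x y"
proof -
  have "\<bar>ip d w x - ip d w y\<bar> = \<bar>\<Sum>i<d. w i * (x i - y i)\<bar>"
    by (simp add: ip_def sum_subtractf right_diff_distrib)
  also have "\<dots> \<le> (\<Sum>i<d. \<bar>w i\<bar> * \<bar>x i - y i\<bar>)"
    by (rule order_trans[OF sum_abs]) (simp add: abs_mult)
  also have "\<dots> \<le> enorm d w * edist d x y"
    unfolding enorm_def edist_def by (rule L2_set_mult_ineq)
  finally show ?thesis .
qed

lemma L2_norm_le:
  assumes "(\<integral>\<^sup>+x\<in>\<Omega>. ennreal ((h x)\<^sup>2) \<partial>leb d) \<le> ennreal (v\<^sup>2 * m)" "0 \<le> v" "0 \<le> m"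
  shows "L2_norm d \<Omega> h \<le> ennreal (sqrt m * v)"
proof -
  let ?I = "\<integral>\<^sup>+x\<in>\<Omega>. ennreal ((h x)\<^sup>2) \<partial>leb d"
  have "?I \<noteq> \<infinity>" using assms(1) by (auto simp: top_unique)
  moreover have "sqrt (enn2real ?I) \<le> sqrt (v\<^sup>2 * m)"
    using assms by (intro real_sqrt_le_mono enn2real_leI) auto
  moreover have "sqrt (v\<^sup>2 * m) = sqrt m * v" using assms by (simp add: real_sqrt_mult)
  ultimately show ?thesis by (auto simp: L2_norm_def Let_def intro!: ennreal_leI)
qed

section \<open>Closure properties of the network classes\<close>

lemma networks_zero: "(\<lambda>_. 0) \<in> networks d 0 \<sigma>"
  by (auto simp: networks_def)

lemma networks_add_neuron:
  assumes "h \<in> networks d n \<sigma>" "w \<in> Rn d"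
  shows "(\<lambda>x. h x + s * \<sigma> (ip d w x + c)) \<in> networks d (Suc n) \<sigma>"
proof -
  obtain W b \<beta> where h: "h = (\<lambda>x. \<Sum>i<n. \<beta> i * \<sigma> (ip d (W i) x + b i))" and W: "\<forall>i<n. W i \<in> Rn d"
    using assms(1) by (auto simp: networks_def)
  define W' b' \<beta>' where "W' = fun_upd W n w" and "b' = fun_upd b n c" and "\<beta>' = fun_upd \<beta> n s"
  have "(\<lambda>x. h x + s * \<sigma> (ip d w x + c)) = (\<lambda>x. \<Sum>i<Suc n. \<beta>' i * \<sigma> (ip d (W' i) x + b' i))"
    by (simp add: h W'_def b'_def \<beta>'_def)
  moreover have "\<forall>i<Suc n. W' i \<in> Rn d" using W assms(2) by (auto simp: less_Suc_eq W'_def)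
  ultimately show ?thesis unfolding networks_def by blast
qed

text \<open>Pads with neurons of coefficient 0. Sampling differences yields an even number of
  neurons, so odd \<open>n\<close> needs this.\<close>

lemma networks_mono:
  assumes "h \<in> networks d m \<sigma>" "m \<le> n"
  shows "h \<in> networks d n \<sigma>"
  using assms(2)
proof (induction n rule: dec_induct)
  case (step n)
  have "restrict (\<lambda>_. 0) {..<d} \<in> Rn d" by (simp add: Rn_def)
  from networks_add_neuron[OF step.IH this, of 0] show ?case by simp
qed (rule assms)

lemma networks_differences:
  assumes "\<And>i. w i \<in> Rn d"
  shows "(\<lambda>x. \<Sum>i<m. s i * (\<sigma> (ip d (w i) x + c i + 1) - \<sigma> (ip d (w i) x + c i))) \<in> networks d (2 * m) \<sigma>"
proof (induction m)
  case 0
  then show ?case by (simp add: networks_zero)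
next
  case (Suc m)
  from networks_add_neuron[OF networks_add_neuron[OF Suc assms, of "s m" m "c m + 1"] assms, of "- s m" m "c m"]
  show ?case by (simp add: algebra_simps)
qed

text \<open>If the transform of the difference vanished off 0, it would vanish at 0 too, by
  continuity, and uniqueness would make \<sigma> periodic with period 1 almost everywhere. A
  periodic function repeats its oscillation in every period, whereas bounded variation forces the
  oscillation far to the right to be arbitrarily small. So \<sigma> would be constant almost
  everywhere.\<close>

lemma exists_nonzero_frequency:
  assumes "mono V" "\<And>t. 0 \<le> V t" "\<And>t. V t \<le> T"
    "\<And>x y. x \<le> y \<Longrightarrow> \<bar>\<sigma> y - \<sigma> x\<bar> \<le> V y - V x"
    and \<sigma>_meas[measurable]: "\<sigma> \<in> borel_measurable borel"
    and nc: "non_constant \<sigma>" and int: "integrable lborel (\<lambda>t. \<sigma> (t + 1) - \<sigma> t)"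
  shows "\<exists>a. a \<noteq> 0 \<and> (LINT t|lborel. complex_of_real (\<sigma> (t + 1) - \<sigma> t) * exp (- \<i> * complex_of_real (a * t))) \<noteq> 0"
proof (rule ccontr)
  assume contra: "\<nexists>a. a \<noteq> 0 \<and> (LINT t|lborel. complex_of_real (\<sigma> (t + 1) - \<sigma> t) * exp (- \<i> * complex_of_real (a * t))) \<noteq> 0"
  define \<eta> where "\<eta> t = complex_of_real (\<sigma> (t + 1) - \<sigma> t)" for t
  have i\<eta>: "integrable lborel \<eta>" unfolding \<eta>_def using int by (rule integrable_of_real)
  note [measurable] = borel_measurable_integrable[OF i\<eta>]
  define H where "H a = (LINT t|lborel. \<eta> t * exp (\<i> * complex_of_real (a * t)))" for a
  have nz: "H a = 0" if "a \<noteq> 0" for a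
    using contra that by (auto simp: H_def \<eta>_def dest!: spec[of _ "- a"])
  have "(\<lambda>n. H (1 / real (Suc n))) \<longlonglongrightarrow> H 0"
    unfolding H_def
  proof (rule integral_dominated_convergence[where w = "\<lambda>t. norm (\<eta> t)"])
    show "integrable lborel (\<lambda>t. norm (\<eta> t))" using i\<eta> by (rule integrable_norm)
    have "(\<lambda>n. 1 / real (Suc n)) \<longlonglongrightarrow> 0" by (rule lim_1_over_n[THEN LIMSEQ_Suc])
    then have "(\<lambda>n. \<eta> t * exp (\<i> * complex_of_real (1 / real (Suc n) * t))) \<longlonglongrightarrow> \<eta> t * exp (\<i> * complex_of_real (0 * t))" for t
      by (intro tendsto_intros)
    then show "AE t in lborel. (\<lambda>n. \<eta> t * exp (\<i> * complex_of_real (1 / real (Suc n) * t))) \<longlonglongrightarrow> \<eta> t * exp (\<i> * complex_of_real (0 * t))"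
      by simp
  qed (auto simp: norm_mult)
  moreover have "H (1 / real (Suc n)) = 0" for n by (rule nz) simp
  ultimately have "H 0 = 0" by (simp add: LIMSEQ_const_iff)
  then have H0: "H a = 0" for a using nz by (cases "a = 0") auto
  have "AE t in lborel. \<eta> t = 0"
    by (rule fourier_uniqueness_lborel[OF i\<eta>]) (use H0 in \<open>simp add: H_def\<close>)
  then have per: "AE t in lborel. \<sigma> (t + 1) = \<sigma> t" by (simp add: \<eta>_def)
  \<comment> \<open>All integer translates are combined first, so that a single null set serves
    every \<open>k\<close> in the induction for fixed \<open>t\<close>.\<close>
  have "AE t in lborel. \<sigma> (real k + t + 1) = \<sigma> (real k + t)" for k :: nat
    using AE_borel_affine[of 1 "\<lambda>t. \<sigma> (t + 1) = \<sigma> t" "real k"] per by simp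
  then have "AE t in lborel. \<forall>k :: nat. \<sigma> (real k + t + 1) = \<sigma> (real k + t)"
    by (simp add: AE_all_countable)
  then have shifts: "AE t in lborel. \<forall>k :: nat. \<sigma> (t + real k) = \<sigma> t"
  proof eventually_elim
    case (elim t)
    show ?case
    proof
      fix k show "\<sigma> (t + real k) = \<sigma> t"
        by (induction k) (use elim in \<open>auto simp: add_ac\<close>)
    qed
  qed
  have "\<exists>c. AE x in lborel. \<sigma> x = c"
  proof -
    have bdd: "bdd_above (range V)" using assms(3) by (intro bdd_aboveI2)
    have eq: "\<sigma> s = \<sigma> t" if s: "\<forall>k :: nat. \<sigma> (s + real k) = \<sigma> s" and t: "\<forall>k :: nat. \<sigma> (t + real k) = \<sigma> t" for s t
    proof -
      have le: "\<bar>\<sigma> s - \<sigma> t\<bar> \<le> e" if "e > 0" for e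
      proof -
        \<comment> \<open>To the right of \<open>u\<close> the function \<open>V\<close> grows by
          less than \<open>e\<close>, and the shift by \<open>k\<close> carries both
          \<open>s\<close> and \<open>t\<close> beyond \<open>u\<close>.\<close>
        obtain u where u: "(SUP x. V x) - e < V u"
          using less_cSUP_iff[OF _ bdd, of "(SUP x. V x) - e"] \<open>e > 0\<close> by auto
        obtain k :: nat where k: "max (u - s) (u - t) < real k" using reals_Archimedean2 by blast
        have V: "V u \<le> V (s + real k)" "V u \<le> V (t + real k)"
          using k by (auto intro!: monoD[OF assms(1)])
        have V': "V x \<le> (SUP x. V x)" for x using bdd by (intro cSUP_upper) auto
        have "\<bar>\<sigma> (s + real k) - \<sigma> (t + real k)\<bar> \<le> \<bar>V (s + real k) - V (t + real k)\<bar>"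
          using assms(4)[of "s + real k" "t + real k"] assms(4)[of "t + real k" "s + real k"]
          by (cases "s \<le> t") auto
        also have "\<dots> \<le> e" using u V V'[of "s + real k"] V'[of "t + real k"] by auto
        finally show ?thesis using s t by simp
      qed
      then show ?thesis using field_le_epsilon[of "\<bar>\<sigma> s - \<sigma> t\<bar>" 0] by simp
    qed
    obtain s where s: "\<forall>k :: nat. \<sigma> (s + real k) = \<sigma> s"
      using eventually_happens[OF shifts] by (auto simp: ae_filter_eq_bot_iff)
    from shifts have "AE x in lborel. \<sigma> x = \<sigma> s"
      by eventually_elim (use eq s in blast)
    then show ?thesis by blast
  qed
  then show False using nc AE_completion by (auto simp: non_constant_def)
qed

section \<open>Integral representation by neurons and its discretisation\<close>

lemma measurable_enorm [measurable]: "enorm d \<in> borel_measurable (leb d)"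
proof -
  have [measurable]: "(\<lambda>x. \<Sum>i<d. (x i)\<^sup>2) \<in> borel_measurable (leb d)"
    by (intro borel_measurable_sum borel_measurable_power measurable_component_leb) auto
  show ?thesis unfolding enorm_def L2_set_def by measurable
qed

lemma fourier_shift:
  fixes \<eta> :: "real \<Rightarrow> complex"
  shows "(LINT b|lborel. \<eta> (s + b) * exp (- \<i> * complex_of_real (a * b))) =
    exp (\<i> * complex_of_real (a * s)) * (LINT t|lborel. \<eta> t * exp (- \<i> * complex_of_real (a * t)))"
proof -
  have "\<eta> (s + b) * exp (- \<i> * complex_of_real (a * b)) = exp (\<i> * complex_of_real (a * s)) *
      (\<eta> (s + 1 * b) * exp (- \<i> * complex_of_real (a * (s + 1 * b))))" for b
    by (simp add: algebra_simps flip: exp_add)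
  then have "(LINT b|lborel. \<eta> (s + b) * exp (- \<i> * complex_of_real (a * b))) =
      exp (\<i> * complex_of_real (a * s)) *
      (LINT b|lborel. \<eta> (s + 1 * b) * exp (- \<i> * complex_of_real (a * (s + 1 * b))))"
    by (simp only: integral_mult_right_zero)
  then show ?thesis
    using lborel_integral_real_affine[of 1 "\<lambda>t. \<eta> t * exp (- \<i> * complex_of_real (a * t))" s] by simp
qed

text \<open>The squared constant bounds the integral of the dominating function \<open>q\<close>,
  which is what importance sampling asks for: \<open>T\<close> is the variation spread over the
  biases, \<open>2 * D / \<bar>a\<bar> + 1\<close> bounds the window length relative to 1 +
  |\<omega>|, \<open>B\<close> integrates the frequencies, and \<open>cmod c\<close> comes from
  solving for the exponential.\<close>

lemma bounded_domain_approximation: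
  fixes \<sigma> V :: "real \<Rightarrow> real" and a T :: real and g :: "(nat \<Rightarrow> real) \<Rightarrow> complex"
  assumes V: "mono V" "\<And>t. 0 \<le> V t" "\<And>t. V t \<le> T"
    and \<sigma>V: "\<And>x y. x \<le> y \<Longrightarrow> \<bar>\<sigma> y - \<sigma> x\<bar> \<le> V y - V x"
    and \<sigma>_meas: "\<sigma> \<in> borel_measurable borel"
    and a: "a \<noteq> 0"
    and c: "c = (LINT t|lborel. complex_of_real (\<sigma> (t + 1) - \<sigma> t) * exp (- \<i> * complex_of_real (a * t)))" "c \<noteq> 0"
    and \<Omega>: "\<Omega> \<in> sets (leb d)" "emeasure (leb d) \<Omega> < \<infinity>" "x0 \<in> \<Omega>"
    and D: "\<And>x. x \<in> \<Omega> \<Longrightarrow> edist d x x0 \<le> D" "0 \<le> D"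
    and g: "g \<in> borel_measurable (leb d)"
    and B: "(\<integral>\<^sup>+\<omega>. ennreal ((1 + enorm d \<omega>) * cmod (g \<omega>)) \<partial>leb d) = ennreal B" "0 \<le> B"
    and f: "AE x in leb d. complex_of_real (f x) = (LINT \<omega>|leb d. g \<omega> * exp (\<i> * complex_of_real (ip d \<omega> x)))"
    and m: "m > 0"
  shows "\<exists>h\<in>networks d (2 * m) \<sigma>. (\<integral>\<^sup>+x\<in>\<Omega>. ennreal ((f x - h x)\<^sup>2) \<partial>leb d) \<le>
    ennreal ((T * (2 * D / \<bar>a\<bar> + 1) * B / cmod c)\<^sup>2 * measure (leb d) \<Omega> / real m)"
proof -
  interpret leb: sigma_finite_measure "leb d" by (rule sigma_finite_leb)
  interpret LB: pair_sigma_finite "leb d" "lborel :: real measure" ..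
  note g[measurable] \<sigma>_meas[measurable]
  have [measurable]: "V \<in> borel_measurable borel" by (rule borel_measurable_mono) fact
  have T: "0 \<le> T" using V(2,3) order_trans by blast
  have ip_meas [measurable]: "(\<lambda>\<omega>. ip d \<omega> z) \<in> borel_measurable (leb d)" for z
    unfolding ip_def by (intro borel_measurable_sum borel_measurable_times borel_measurable_const measurable_component_leb) auto
  define \<kappa> where "\<kappa> = 2 * D / \<bar>a\<bar> + 1"
  have \<kappa>: "1 \<le> \<kappa>" using D(2) by (simp add: \<kappa>_def)
  define N where "N = leb d \<Otimes>\<^sub>M (lborel :: real measure)"
  define M where "M = restrict_space (leb d) \<Omega>"
  have \<Omega>_sub: "\<Omega> \<subseteq> Rn d" using sets.sets_into_space[OF \<Omega>(1)] by (simp add: space_leb)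
  have sM: "space M = \<Omega>" using \<Omega>_sub by (auto simp: M_def space_restrict_space space_leb)
  have sN: "space N = Rn d \<times> UNIV" by (simp add: N_def space_pair_measure space_leb)
  have finM: "finite_measure M"
    using \<Omega> by (intro finite_measureI) (simp add: sM, simp add: M_def emeasure_restrict_space)
  have idM: "(\<lambda>x. x) \<in> measurable M (leb d)" unfolding M_def by (rule measurable_restrict_space1) simp
  define L where "L \<omega> = enorm d \<omega> * D / \<bar>a\<bar>" for \<omega>
  have L: "0 \<le> L \<omega>" for \<omega> using D(2) by (simp add: L_def enorm_def L2_set_nonneg)
  have [measurable]: "L \<in> borel_measurable (leb d)" unfolding L_def by measurable
  \<comment> \<open>For |s| <= L both arguments s + b and s + b + 1 lie between b - L and b + L + 1.
    The growth of \<open>V\<close> over this window hence dominates the neuron difference for all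
    points of \<Omega> at once.\<close>
  define q where "q = (\<lambda>(\<omega>, b). cmod (g \<omega>) / cmod c * (V (b + L \<omega> + 1) - V (b - L \<omega>)))"
  have q_nonneg: "0 \<le> q t" for t
  proof -
    have "V (snd t - L (fst t)) \<le> V (snd t + L (fst t) + 1)"
      using L[of "fst t"] by (intro monoD[OF V(1)]) linarith
    then show ?thesis by (simp add: q_def case_prod_beta)
  qed
  have [measurable]: "q \<in> borel_measurable N" unfolding q_def N_def by measurable
  have "(\<integral>\<^sup>+t. ennreal (q t) \<partial>N) = (\<integral>\<^sup>+\<omega>. (\<integral>\<^sup>+b. ennreal (q (\<omega>, b)) \<partial>lborel) \<partial>leb d)"
    unfolding N_def by (rule lborel.nn_integral_fst[symmetric]) (simp add: N_def[symmetric])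
  also have "\<dots> \<le> (\<integral>\<^sup>+\<omega>. ennreal (T * \<kappa> / cmod c) * ennreal ((1 + enorm d \<omega>) * cmod (g \<omega>)) \<partial>leb d)"
  proof (rule nn_integral_mono)
    fix \<omega>
    have e: "0 \<le> enorm d \<omega>" by (simp add: enorm_def L2_set_nonneg)
    have "(\<integral>\<^sup>+b. ennreal (V ((b - L \<omega>) + (2 * L \<omega> + 1)) - V (b - L \<omega>)) \<partial>lborel) =
        (\<integral>\<^sup>+b. ennreal (V (b + (2 * L \<omega> + 1)) - V b) \<partial>lborel)"
      using nn_integral_real_affine[of "\<lambda>b. ennreal (V (b + (2 * L \<omega> + 1)) - V b)" 1 "- L \<omega>"] by simp
    also have "\<dots> \<le> ennreal ((2 * L \<omega> + 1) * T)"
      by (rule nn_integral_shift_increment_le) (use V L[of \<omega>] in auto)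
    finally have V_int: "(\<integral>\<^sup>+b. ennreal (V ((b - L \<omega>) + (2 * L \<omega> + 1)) - V (b - L \<omega>)) \<partial>lborel) \<le>
        ennreal ((2 * L \<omega> + 1) * T)" .
    have "(\<integral>\<^sup>+b. ennreal (q (\<omega>, b)) \<partial>lborel) =
        (\<integral>\<^sup>+b. ennreal (cmod (g \<omega>) / cmod c) * ennreal (V ((b - L \<omega>) + (2 * L \<omega> + 1)) - V (b - L \<omega>)) \<partial>lborel)"
      by (intro nn_integral_cong) (simp add: q_def ennreal_mult'[symmetric] algebra_simps)
    also have "\<dots> = ennreal (cmod (g \<omega>) / cmod c) * (\<integral>\<^sup>+b. ennreal (V ((b - L \<omega>) + (2 * L \<omega> + 1)) - V (b - L \<omega>)) \<partial>lborel)"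
      by (rule nn_integral_cmult) measurable
    also have "\<dots> \<le> ennreal (cmod (g \<omega>) / cmod c) * ennreal ((2 * L \<omega> + 1) * T)"
      by (rule mult_left_mono[OF V_int]) simp
    also have "\<dots> = ennreal (cmod (g \<omega>) / cmod c * ((2 * L \<omega> + 1) * T))"
      using L[of \<omega>] T by (intro ennreal_mult''[symmetric]) simp
    also have "\<dots> \<le> ennreal (cmod (g \<omega>) / cmod c * ((\<kappa> * (1 + enorm d \<omega>)) * T))"
    proof -
      \<comment> \<open>With e = |\<omega>| the claim is 2 r e + 1 <= (2 r + 1) (1 + e). Here the
        window length turns into the Barron weight.\<close>
      define r where "r = D / \<bar>a\<bar>"
      have "0 \<le> r" "L \<omega> = enorm d \<omega> * r" "\<kappa> = 2 * r + 1"
        using D(2) by (simp_all add: r_def L_def \<kappa>_def)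
      then have "2 * L \<omega> + 1 \<le> \<kappa> * (1 + enorm d \<omega>)"
        using e by (simp add: algebra_simps)
      then show ?thesis using T by (intro ennreal_leI mult_left_mono mult_right_mono) auto
    qed
    also have "\<dots> = ennreal (T * \<kappa> / cmod c) * ennreal ((1 + enorm d \<omega>) * cmod (g \<omega>))"
      using T \<kappa> by (simp add: ennreal_mult'[symmetric] mult_ac)
    finally show "(\<integral>\<^sup>+b. ennreal (q (\<omega>, b)) \<partial>lborel) \<le>
        ennreal (T * \<kappa> / cmod c) * ennreal ((1 + enorm d \<omega>) * cmod (g \<omega>))" .
  qed
  also have "\<dots> = ennreal (T * \<kappa> / cmod c) * (\<integral>\<^sup>+\<omega>. ennreal ((1 + enorm d \<omega>) * cmod (g \<omega>)) \<partial>leb d)"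
    by (rule nn_integral_cmult) measurable
  also have "\<dots> = ennreal (T * \<kappa> * B / cmod c)"
    using T \<kappa> B by (simp add: ennreal_mult'[symmetric])
  finally have q_le: "(\<integral>\<^sup>+t. ennreal (q t) \<partial>N) \<le> ennreal (T * \<kappa> * B / cmod c)" .
  have iq: "integrable N q"
    by (rule integrableI_nonneg) (use q_le q_nonneg in \<open>auto intro: le_less_trans\<close>)
  have q_int: "(LINT t|N. q t) \<le> T * \<kappa> * B / cmod c"
    using q_le T \<kappa> B q_nonneg nn_integral_eq_integral[OF iq] by simp
  define k where "k = (\<lambda>(\<omega>, b) x. g \<omega> * exp (\<i> * complex_of_real (ip d \<omega> x0)) * exp (- \<i> * complex_of_real (a * b)) / c *
    complex_of_real (\<sigma> ((ip d \<omega> x - ip d \<omega> x0) / a + b + 1) - \<sigma> ((ip d \<omega> x - ip d \<omega> x0) / a + b)))"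
  \<comment> \<open>Since \<open>f\<close> and the neurons are real, taking real parts changes only
    the coefficient and not the function represented.\<close>
  define K where "K t x = Re (k t x)" for t x
  have k_bound: "cmod (k t x) \<le> q t" if x: "x \<in> \<Omega>" for t x
  proof -
    obtain \<omega> b where t: "t = (\<omega>, b)" by (cases t)
    define s where "s = (ip d \<omega> x - ip d \<omega> x0) / a"
    have "\<bar>ip d \<omega> x - ip d \<omega> x0\<bar> \<le> enorm d \<omega> * D"
      by (rule order_trans[OF ip_diff_bound mult_left_mono[OF D(1)[OF x]]]) (simp add: enorm_def L2_set_nonneg)
    then have s: "\<bar>s\<bar> \<le> L \<omega>" by (simp add: s_def L_def divide_right_mono)
    have "\<bar>\<sigma> (s + b + 1) - \<sigma> (s + b)\<bar> \<le> V (s + b + 1) - V (s + b)" by (rule \<sigma>V) simp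
    also have "\<dots> \<le> V (b + L \<omega> + 1) - V (b - L \<omega>)"
      using s by (intro diff_mono monoD[OF V(1)]) auto
    finally have "cmod (g \<omega>) / cmod c * \<bar>\<sigma> (s + b + 1) - \<sigma> (s + b)\<bar> \<le> q t"
      unfolding q_def t prod.case by (rule mult_left_mono) simp
    moreover have "cmod (k t x) = cmod (g \<omega>) / cmod c * \<bar>\<sigma> (s + b + 1) - \<sigma> (s + b)\<bar>"
      unfolding k_def t prod.case s_def[symmetric] by (simp add: norm_mult norm_divide flip: of_real_diff)
    ultimately show ?thesis by simp
  qed
  have k_meas: "(\<lambda>(t, x). k t x) \<in> borel_measurable (N \<Otimes>\<^sub>M leb d)"
  proof -
    have [measurable]: "(\<lambda>z. snd (fst z)) \<in> borel_measurable (N \<Otimes>\<^sub>M leb d)"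
      "(\<lambda>z. fst (fst z)) \<in> measurable (N \<Otimes>\<^sub>M leb d) (leb d)" unfolding N_def by measurable
    show ?thesis unfolding k_def case_prod_beta by measurable
  qed
  have k_measx: "(\<lambda>t. k t x) \<in> borel_measurable N" if "x \<in> \<Omega>" for x
    using measurable_Pair1[OF k_meas, of x] that \<Omega>_sub by (auto simp: space_leb)
  have K_meas: "(\<lambda>(t, x). K t x) \<in> borel_measurable (N \<Otimes>\<^sub>M M)"
  proof -
    have "(\<lambda>z. (fst z, snd z)) \<in> measurable (N \<Otimes>\<^sub>M M) (N \<Otimes>\<^sub>M leb d)"
      by (intro measurable_Pair measurable_fst measurable_compose[OF measurable_snd idM])
    from measurable_compose[OF this k_meas] show ?thesis
      by (simp add: K_def case_prod_beta)
  qed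
  have ik: "integrable N (\<lambda>t. k t x)" if "x \<in> \<Omega>" for x
    by (rule Bochner_Integration.integrable_bound[OF iq k_measx[OF that]])
      (use k_bound[OF that] q_nonneg in auto)
  have k_int: "(LINT t|N. k t x) = (LINT \<omega>|leb d. g \<omega> * exp (\<i> * complex_of_real (ip d \<omega> x)))" if x: "x \<in> \<Omega>" for x
  proof -
    have "(LINT t|N. k t x) = (LINT \<omega>|leb d. (LINT b|lborel. k (\<omega>, b) x))"
      unfolding N_def by (rule LB.integral_fst'[symmetric]) (use ik[OF x] in \<open>simp add: N_def\<close>)
    also have "\<dots> = (LINT \<omega>|leb d. g \<omega> * exp (\<i> * complex_of_real (ip d \<omega> x)))"
    proof (intro Bochner_Integration.integral_cong refl)
      fix \<omega>
      define s where "s = (ip d \<omega> x - ip d \<omega> x0) / a"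
      have as: "a * s = ip d \<omega> x - ip d \<omega> x0" using a by (simp add: s_def)
      define w where "w = g \<omega> * exp (\<i> * complex_of_real (ip d \<omega> x0)) / c"
      have "k (\<omega>, b) x = w * (complex_of_real (\<sigma> ((s + b) + 1) - \<sigma> (s + b)) * exp (- \<i> * complex_of_real (a * b)))" for b
        unfolding k_def prod.case s_def[symmetric] w_def by (simp add: mult_ac)
      then have "(LINT b|lborel. k (\<omega>, b) x) = w *
          (LINT b|lborel. complex_of_real (\<sigma> ((s + b) + 1) - \<sigma> (s + b)) * exp (- \<i> * complex_of_real (a * b)))"
        by (simp only: integral_mult_right_zero)
      also have "\<dots> = w * (exp (\<i> * complex_of_real (a * s)) * c)"
        unfolding c(1) by (subst fourier_shift[of "\<lambda>t. complex_of_real (\<sigma> (t + 1) - \<sigma> t)"]) simp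
      also have "\<dots> = g \<omega> * exp (\<i> * complex_of_real (ip d \<omega> x0) + \<i> * complex_of_real (a * s))"
        using c(2) by (simp add: w_def exp_add)
      also have "\<i> * complex_of_real (ip d \<omega> x0) + \<i> * complex_of_real (a * s) = \<i> * complex_of_real (ip d \<omega> x)"
        by (simp only: as) (simp add: algebra_simps)
      finally show "(LINT b|lborel. k (\<omega>, b) x) = g \<omega> * exp (\<i> * complex_of_real (ip d \<omega> x))" .
    qed
    finally show ?thesis .
  qed
  have fK: "AE x in leb d. x \<in> \<Omega> \<longrightarrow> f x = (LINT t|N. K t x)"
    using f
  proof eventually_elim
    case (elim x)
    show ?case
    proof
      assume x: "x \<in> \<Omega>"
      have "(LINT t|N. K t x) = Re (LINT t|N. k t x)" unfolding K_def using ik[OF x] by simp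
      then show "f x = (LINT t|N. K t x)" using elim k_int[OF x] by (metis Re_complex_of_real)
    qed
  qed
  have sfN: "sigma_finite_measure N" unfolding N_def by (rule LB.sigma_finite_measure_axioms)
  have "\<exists>\<theta> \<beta>. (\<forall>i. \<theta> i \<in> space N) \<and>
    (\<integral>\<^sup>+x. ennreal (((LINT t|N. K t x) - (\<Sum>i<m. \<beta> i * K (\<theta> i) x))\<^sup>2) \<partial>M) \<le>
      ennreal ((LINT t|N. q t)\<^sup>2 * measure M (space M) / real m)"
  proof (rule weighted_monte_carlo[OF sfN _ finM K_meas iq _ q_nonneg m])
    show "space N \<noteq> {}" using \<Omega>(3) \<Omega>_sub by (auto simp: sN)
    show "\<bar>K t x\<bar> \<le> q t" if "t \<in> space N" "x \<in> space M" for t x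
      unfolding K_def using that k_bound[of x t] abs_Re_le_cmod[of "k t x"] by (simp add: sM)
  qed
  then obtain \<theta> \<beta> where \<theta>: "\<forall>i. \<theta> i \<in> space N"
    and le: "(\<integral>\<^sup>+x. ennreal (((LINT t|N. K t x) - (\<Sum>i<m. \<beta> i * K (\<theta> i) x))\<^sup>2) \<partial>M) \<le>
      ennreal ((LINT t|N. q t)\<^sup>2 * measure M (space M) / real m)" by blast
  \<comment> \<open>A sample (\<omega>, b) becomes the inner weight \<omega> / a with the centring
    at \<open>x0\<close> absorbed into the bias. The restricted abstraction keeps the weight in
    \<open>Rn d\<close>.\<close>
  define w where "w i = (\<lambda>j\<in>{..<d}. fst (\<theta> i) j / a)" for i
  define b where "b i = snd (\<theta> i) - ip d (fst (\<theta> i)) x0 / a" for i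
  define s where "s i = \<beta> i * Re (g (fst (\<theta> i)) * exp (\<i> * complex_of_real (ip d (fst (\<theta> i)) x0)) *
    exp (- \<i> * complex_of_real (a * snd (\<theta> i))) / c)" for i
  define h where "h x = (\<Sum>i<m. s i * (\<sigma> (ip d (w i) x + b i + 1) - \<sigma> (ip d (w i) x + b i)))" for x
  have "h \<in> networks d (2 * m) \<sigma>"
    unfolding h_def by (rule networks_differences) (simp add: w_def Rn_def PiE_iff extensional_def)
  moreover have hK: "h x = (\<Sum>i<m. \<beta> i * K (\<theta> i) x)" for x
    unfolding h_def
  proof (intro sum.cong refl)
    fix i
    have "ip d (w i) x = ip d (fst (\<theta> i)) x / a"
      by (simp add: ip_def w_def sum_divide_distrib)
    then have eq: "ip d (w i) x + b i = (ip d (fst (\<theta> i)) x - ip d (fst (\<theta> i)) x0) / a + snd (\<theta> i)"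
      by (simp add: b_def diff_divide_distrib)
    have re: "Re (z * complex_of_real r) = Re z * r" for z r by simp
    show "s i * (\<sigma> (ip d (w i) x + b i + 1) - \<sigma> (ip d (w i) x + b i)) = \<beta> i * K (\<theta> i) x"
      by (simp only: K_def k_def s_def case_prod_beta re eq)
  qed
  moreover have "(\<integral>\<^sup>+x\<in>\<Omega>. ennreal ((f x - h x)\<^sup>2) \<partial>leb d) \<le>
    ennreal ((T * \<kappa> * B / cmod c)\<^sup>2 * measure (leb d) \<Omega> / real m)"
  proof -
    have "(\<integral>\<^sup>+x\<in>\<Omega>. ennreal ((f x - h x)\<^sup>2) \<partial>leb d) =
        (\<integral>\<^sup>+x\<in>\<Omega>. ennreal (((LINT t|N. K t x) - (\<Sum>i<m. \<beta> i * K (\<theta> i) x))\<^sup>2) \<partial>leb d)"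
      by (rule nn_integral_cong_AE) (use fK in \<open>eventually_elim, auto simp: hK split: split_indicator\<close>)
    also have "\<dots> = (\<integral>\<^sup>+x. ennreal (((LINT t|N. K t x) - (\<Sum>i<m. \<beta> i * K (\<theta> i) x))\<^sup>2) \<partial>M)"
      unfolding M_def using \<Omega>(1) by (subst nn_integral_restrict_space) auto
    also note le
    also have "measure M (space M) = measure (leb d) \<Omega>"
      unfolding sM unfolding M_def using \<Omega>(1) by (simp add: measure_restrict_space)
    also have "ennreal ((LINT t|N. q t)\<^sup>2 * measure (leb d) \<Omega> / real m) \<le>
        ennreal ((T * \<kappa> * B / cmod c)\<^sup>2 * measure (leb d) \<Omega> / real m)"
      using q_int q_nonneg by (intro ennreal_leI divide_right_mono mult_right_mono power_mono) auto
    finally show ?thesis .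
  qed
  ultimately show ?thesis unfolding \<kappa>_def by blast
qed

section \<open>Choice of the constant and of the number of samples\<close>

theorem corollary3:
  fixes \<sigma> :: "real \<Rightarrow> real"
  assumes "\<sigma> \<in> BV" and "non_constant \<sigma>"
  shows "\<exists>C :: real \<Rightarrow> real.
    \<forall>(d::nat) (\<Omega> :: (nat \<Rightarrow> real) set). d \<ge> 1 \<longrightarrow> bounded_domain d \<Omega> \<longrightarrow>
      (\<forall>f \<in> barron_space d 1. \<forall>n::nat. n \<ge> 1 \<longrightarrow>
        (INF g \<in> networks d n \<sigma>. L2_norm d \<Omega> (\<lambda>x. f x - g x))
          \<le> ennreal (sqrt (measure (leb d) \<Omega>) * C (diam d \<Omega>) * real n powr (- 1 / 4))
              * barron_norm d 1 f)"
proof -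
  obtain V T where V: "mono V" "\<And>t. 0 \<le> V t" "\<And>t. V t \<le> T"
    and \<sigma>V: "\<And>x y. x \<le> y \<Longrightarrow> \<bar>\<sigma> y - \<sigma> x\<bar> \<le> V y - V x"
    using BV_variation_function[OF assms(1)] by blast
  have T: "0 \<le> T" using V(2,3) order_trans by blast
  \<comment> \<open>Jordan decomposition: as a difference of the monotone functions \<open>V\<close>
    and \<open>V - \<sigma>\<close>, \<sigma> is Borel measurable.\<close>
  have "mono (\<lambda>t. V t - \<sigma> t)"
    by (rule monoI) (use \<sigma>V in \<open>fastforce simp: abs_le_iff\<close>)
  then have "(\<lambda>t. V t - (V t - \<sigma> t)) \<in> borel_measurable borel"
    using V(1) by (intro borel_measurable_diff borel_measurable_mono)
  then have \<sigma>_meas[measurable]: "\<sigma> \<in> borel_measurable borel" by simp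
  have int: "integrable lborel (\<lambda>t. \<sigma> (t + 1) - \<sigma> t)"
  proof (rule integrableI_bounded)
    have "(\<integral>\<^sup>+t. ennreal (norm (\<sigma> (t + 1) - \<sigma> t)) \<partial>lborel) \<le> (\<integral>\<^sup>+t. ennreal (V (t + 1) - V t) \<partial>lborel)"
      using \<sigma>V by (intro nn_integral_mono ennreal_leI) auto
    also have "\<dots> \<le> ennreal (1 * T)"
      by (rule nn_integral_shift_increment_le) (use V in auto)
    finally show "(\<integral>\<^sup>+t. ennreal (norm (\<sigma> (t + 1) - \<sigma> t)) \<partial>lborel) < \<infinity>"
      by (auto intro: le_less_trans)
  qed measurable
  obtain a where a: "a \<noteq> 0"
    and "(LINT t|lborel. complex_of_real (\<sigma> (t + 1) - \<sigma> t) * exp (- \<i> * complex_of_real (a * t))) \<noteq> 0"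
    using exists_nonzero_frequency[OF V \<sigma>V \<sigma>_meas assms(2) int] by blast
  then obtain c where c: "c = (LINT t|lborel. complex_of_real (\<sigma> (t + 1) - \<sigma> t) * exp (- \<i> * complex_of_real (a * t)))" "c \<noteq> 0"
    by blast
  \<comment> \<open>Besides \<open>D\<close>, only \<open>T\<close>, \<open>a\<close> and
    \<open>c\<close> enter, all obtained from \<sigma> before the dimension is fixed. The factor 2
    pays for passing from the number of samples to \<open>n\<close>, the summand 1 for the case
    \<open>n = 1\<close>.\<close>
  define C where "C D = 1 + 2 * (T * (2 * D / \<bar>a\<bar> + 1) / cmod c)" for D
  show ?thesis
  proof (intro exI[of _ C] allI impI ballI)
    fix d n :: nat and \<Omega> f
    assume "1 \<le> d" and bd: "bounded_domain d \<Omega>" and fB: "f \<in> barron_space d 1" and n: "1 \<le> n"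
    obtain R x0 where R: "\<And>x. x \<in> \<Omega> \<Longrightarrow> enorm d x \<le> R" and x0: "x0 \<in> \<Omega>"
      using bd by (auto simp: bounded_domain_def)
    have \<Omega>: "\<Omega> \<in> sets (leb d)"
      using bd by (intro openin_Rn_topology_sets) (auto simp: bounded_domain_def)
    have \<Omega>_fin: "emeasure (leb d) \<Omega> < \<infinity>" using \<Omega> R by (rule emeasure_leb_bounded)
    define D where "D = diam d \<Omega>"
    have D: "edist d x x0 \<le> D" if "x \<in> \<Omega>" for x
      unfolding D_def using R that x0 by (rule edist_le_diam)
    have D0: "0 \<le> D" using D[OF x0] by (rule order_trans[rotated]) (simp add: edist_def L2_set_nonneg)
    \<comment> \<open>The Barron norm integrates the transform selected by \<open>SOME\<close>, so
      inversion is run for this very function.\<close>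
    define g where "g = fourier_transform d f"
    have fg: "has_fourier_transform d (\<lambda>x. complex_of_real (f x)) g"
    proof -
      have "\<exists>g. has_fourier_transform d (\<lambda>x. complex_of_real (f x)) g"
        using fB by (simp add: barron_space_def)
      then show ?thesis unfolding g_def fourier_transform_def by (rule someI_ex)
    qed
    then have [measurable]: "g \<in> borel_measurable (leb d)" by (simp add: has_fourier_transform_def tempered_def)
    have nn: "0 \<le> enorm d \<omega>" for \<omega> by (simp add: enorm_def L2_set_nonneg)
    have norm_eq: "barron_norm d 1 f = (\<integral>\<^sup>+\<omega>. ennreal ((1 + enorm d \<omega>) * cmod (g \<omega>)) \<partial>leb d)"
      using nn by (simp add: barron_norm_def g_def add_nonneg_nonneg)
    obtain B where B: "barron_norm d 1 f = ennreal B" "0 \<le> B"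
      using fB by (cases "barron_norm d 1 f") (auto simp: barron_space_def)
    have g_le: "(\<integral>\<^sup>+\<omega>. ennreal (cmod (g \<omega>)) \<partial>leb d) \<le> ennreal B"
      unfolding B(1)[symmetric] norm_eq using nn by (intro nn_integral_mono ennreal_leI) (auto simp: algebra_simps)
    have ig: "integrable (leb d) g"
      by (rule integrableI_bounded) (use g_le in \<open>auto intro: le_less_trans\<close>)
    have inv: "AE x in leb d. complex_of_real (f x) = (LINT \<omega>|leb d. g \<omega> * exp (\<i> * complex_of_real (ip d \<omega> x)))"
      by (rule has_fourier_transform_inversion[OF fg ig])
    define \<mu> where "\<mu> = measure (leb d) \<Omega>"
    have \<mu>: "0 \<le> \<mu>" by (simp add: \<mu>_def)
    define A where "A = T * (2 * D / \<bar>a\<bar> + 1) / cmod c"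
    have CD: "C D = 1 + 2 * A" by (simp add: C_def A_def)
    have A: "0 \<le> A" using T D0 by (simp add: A_def)
    have reduce: "(INF g \<in> networks d n \<sigma>. L2_norm d \<Omega> (\<lambda>x. f x - g x)) \<le>
        ennreal (sqrt \<mu> * C D * real n powr (- 1 / 4)) * ennreal B"
      if h: "h \<in> networks d n \<sigma>" and v: "0 \<le> v" "v \<le> C D * real n powr (- 1 / 4) * B"
        and le: "(\<integral>\<^sup>+x\<in>\<Omega>. ennreal ((f x - h x)\<^sup>2) \<partial>leb d) \<le> ennreal (v\<^sup>2 * \<mu>)" for h v
    proof -
      have "(INF g \<in> networks d n \<sigma>. L2_norm d \<Omega> (\<lambda>x. f x - g x)) \<le> L2_norm d \<Omega> (\<lambda>x. f x - h x)"
        using h by (rule INF_lower)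
      also have "\<dots> \<le> ennreal (sqrt \<mu> * v)" by (rule L2_norm_le[OF le v(1) \<mu>])
      also have "\<dots> \<le> ennreal (sqrt \<mu> * (C D * real n powr (- 1 / 4) * B))"
        using v \<mu> by (intro ennreal_leI mult_left_mono) auto
      also have "\<dots> = ennreal (sqrt \<mu> * C D * real n powr (- 1 / 4)) * ennreal B"
        by (simp only: mult.assoc[symmetric] ennreal_mult''[OF B(2)])
      finally show ?thesis .
    qed
    have "(INF g \<in> networks d n \<sigma>. L2_norm d \<Omega> (\<lambda>x. f x - g x)) \<le>
        ennreal (sqrt \<mu> * C D * real n powr (- 1 / 4)) * ennreal B"
    proof (cases "n = 1")
      \<comment> \<open>A single neuron does not afford a difference, so the zero network is used:
        inversion bounds |f| almost everywhere by the integral of |g|, which is at most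
        \<open>B\<close>.\<close>
      case True
      show ?thesis
      proof (rule reduce)
        show "(\<lambda>_. 0) \<in> networks d n \<sigma>" by (rule networks_mono[OF networks_zero]) simp
        show "B \<le> C D * real n powr (- 1 / 4) * B"
          using True A B(2) by (simp add: CD mult_right_mono[of 1 _ B, simplified])
        have "AE x in leb d. \<bar>f x\<bar> \<le> B"
          using inv
        proof eventually_elim
          case (elim x)
          have "\<bar>f x\<bar> = cmod (complex_of_real (f x))" by simp
          also have "\<dots> \<le> (LINT \<omega>|leb d. cmod (g \<omega> * exp (\<i> * complex_of_real (ip d \<omega> x))))"
            unfolding elim by (rule integral_norm_bound)
          also have "\<dots> = (LINT \<omega>|leb d. cmod (g \<omega>))" by (simp add: norm_mult)
          also have "\<dots> \<le> B"
            using g_le B(2) nn_integral_eq_integral[OF integrable_norm[OF ig]] by simp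
          finally show ?case .
        qed
        then have "AE x in leb d. ennreal ((f x - 0)\<^sup>2) * indicator \<Omega> x \<le> ennreal (B\<^sup>2) * indicator \<Omega> x"
          by eventually_elim (use B(2) in \<open>auto split: split_indicator intro!: ennreal_leI abs_le_square_iff[THEN iffD1]\<close>)
        then have "(\<integral>\<^sup>+x\<in>\<Omega>. ennreal ((f x - 0)\<^sup>2) \<partial>leb d) \<le> (\<integral>\<^sup>+x\<in>\<Omega>. ennreal (B\<^sup>2) \<partial>leb d)"
          by (rule nn_integral_mono_AE)
        also have "\<dots> = ennreal (B\<^sup>2 * \<mu>)"
          using \<Omega> \<Omega>_fin by (simp add: nn_integral_cmult_indicator \<mu>_def emeasure_eq_ennreal_measure ennreal_mult less_top)
        finally show "(\<integral>\<^sup>+x\<in>\<Omega>. ennreal ((f x - 0)\<^sup>2) \<partial>leb d) \<le> ennreal (B\<^sup>2 * \<mu>)" .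
      qed (rule B(2))
    next
      case False
      define m where "m = n div 2"
      \<comment> \<open>The last bound is attained at \<open>n = 3\<close>, where one neuron is left
        over.\<close>
      have m: "m > 0" "2 * m \<le> n" "n \<le> 3 * m" using n False by (auto simp: m_def)
      obtain h where h: "h \<in> networks d (2 * m) \<sigma>" and le: "(\<integral>\<^sup>+x\<in>\<Omega>. ennreal ((f x - h x)\<^sup>2) \<partial>leb d) \<le>
          ennreal ((A * B)\<^sup>2 * \<mu> / real m)"
        using bounded_domain_approximation[OF V \<sigma>V \<sigma>_meas a c \<Omega> \<Omega>_fin x0 D D0 _ _ B(2) inv m(1)]
          B(1) norm_eq by (auto simp: A_def \<mu>_def)
      show ?thesis
      proof (rule reduce)
        show "h \<in> networks d n \<sigma>" by (rule networks_mono[OF h m(2)])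
        show "0 \<le> A * B / sqrt (real m)" using A B(2) by simp
        show "(\<integral>\<^sup>+x\<in>\<Omega>. ennreal ((f x - h x)\<^sup>2) \<partial>leb d) \<le> ennreal ((A * B / sqrt (real m))\<^sup>2 * \<mu>)"
          using le by (simp add: power_divide)
        \<comment> \<open>From n <= 4 m one gets sqrt n <= 2 sqrt m. The exponent 1/2 is relaxed to
          1/4 only here.\<close>
        have "1 / sqrt (real m) \<le> 2 * real n powr (- 1 / 4)"
        proof -
          have "real n powr (1 / 4) \<le> real n powr (1 / 2)" using n by (intro powr_mono) auto
          also have "\<dots> = sqrt (real n)" using n by (simp add: powr_half_sqrt)
          also have "\<dots> \<le> sqrt (4 * real m)" using m by (intro real_sqrt_le_mono) simp
          also have "\<dots> = 2 * sqrt (real m)" by (simp add: real_sqrt_mult)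
          finally show ?thesis using m(1) n by (simp add: powr_minus field_simps)
        qed
        then have "A * B * (1 / sqrt (real m)) \<le> A * B * (2 * real n powr (- 1 / 4))"
          using A B(2) by (intro mult_left_mono) auto
        also have "\<dots> \<le> C D * real n powr (- 1 / 4) * B"
          using B(2) by (simp add: CD algebra_simps)
        finally show "A * B / sqrt (real m) \<le> C D * real n powr (- 1 / 4) * B" by simp
      qed
    qed
    then show "(INF g \<in> networks d n \<sigma>. L2_norm d \<Omega> (\<lambda>x. f x - g x)) \<le>
        ennreal (sqrt (measure (leb d) \<Omega>) * C (diam d \<Omega>) * real n powr (- 1 / 4)) * barron_norm d 1 f"
      unfolding B(1) \<mu>_def D_def .
  qed
qed

end
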